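(* Let $\mathbb{G}$ be a totally ordered Abelian group with $\operatorname{Deg}(\mathbb{G})=\kappa$. The class of $\mathbb{G}$-Polish spaces (equivalently: of $\kappa$-additive $f\mathrm{SC}_\kappa$-spaces) is closed under $G^\kappa_\delta$ subspaces, under sums of at most $\kappa$-many spaces, and under products of at most $\kappa$-many spaces (where products carry the ${<}\kappa$-supported product topology).
   Context: Work in ZFC; $\kappa$ is an uncountable regular cardinal with $2^{<\kappa}=\kappa$ (equivalently $\kappa^{<\kappa}=\kappa$). "Space" means regular Hausdorff topological space. A $G^\kappa_\delta$ subset of a space is an intersection of $\kappa$-many open sets (repetitions allowed). Sums are disjoint topological sums. The ${<}\kappa$-supported product topology on $\prod_{i\in I}X_i$ is generated by the sets $\prod_{i\in I}U_i$ with each $U_i$ open in $X_i$ and $U_i\neq X_i$ for fewer than $\kappa$-many $i$. A space is $\kappa$-additive if its topology is closed under intersections of fewer than $\kappa$ open sets. For a totally ordered (with translation-invariant linear order) Abelian group $\mathbb{G}$, $\mathbb{G}^+=\{\varepsilon\in\mathbb{G}\mid 0<\varepsilon\}$ and $\operatorname{Deg}(\mathbb{G})$ is the coinitiality of $\mathbb{G}^+$. A $\mathbb{G}$-metric on $X$ is a map $d\colon X^2\to\mathbb{G}^+\cup\{0\}$ with $d(x,y)=0\iff x=y$, $d(x,y)=d(y,x)$, $d(x,z)\le d(x,y)+d(y,z)$; its topology is generated by the balls $\{y\mid d(x,y)<\varepsilon\}$, $\varepsilon\in\mathbb{G}^+$, and $d$ is compatible with a topology if it generates it. $d$ is Cauchy-complete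 if every $d$-Cauchy sequence of length $\kappa$ converges. $X$ is $\mathbb{G}$-Polish if it has weight $\le\kappa$ and admits a compatible Cauchy-complete $\mathbb{G}$-metric (the empty space is allowed). Strong fair $\kappa$-Choquet game $f\mathrm{G}^s_\kappa(X)$: players I and II play $\kappa$-many rounds. In round $\alpha<\kappa$, I plays $(U_\alpha,x_\alpha)$ with $U_\alpha$ a relatively open subset of $\bigcap_{\beta<\alpha}V_\beta$ (which is $X$ if $\alpha=0$) and $x_\alpha\in U_\alpha$; then II plays a relatively open subset $V_\alpha$ of $\bigcap_{\beta<\alpha}V_\beta$ with $x_\alpha\in V_\alpha\subseteq U_\alpha$. If $\bigcap_{\alpha<\gamma}V_\alpha=\emptyset$ for some limit $\gamma<\kappa$, the run ends and II wins. If the run lasts $\kappa$ rounds, II wins iff $\bigcap_{\alpha<\kappa}V_\alpha\neq\emptyset$. $X$ is an $f\mathrm{SC}_\kappa$-space if it has weight $\le\kappa$ and II has a winning strategy in $f\mathrm{G}^s_\kappa(X)$. (The empty space, where I has no legal move, counts as such.) *)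

theory Defs
  imports "HOL-Analysis.Analysis"
begin

unbundle cardinal_syntax

text \<open>
  Throughout, a cardinal \<open>\<kappa>\<close> is a cardinal order \<open>k :: 'k rel\<close> in the sense of the library
  (\<open>Card_order k\<close>). Its ordinals \<open>\<alpha> < \<kappa>\<close> are the elements of \<open>Field k\<close>, and
  \<open>underS k \<alpha> = {\<beta>. \<beta> < \<alpha>}\<close>, \<open>under k \<alpha> = {\<beta>. \<beta> \<le> \<alpha>}\<close>.
\<close>

text \<open>
  \<open>2\<^sup><\<^sup>\<kappa>\<close> is the number of binary sequences of length \<open>< \<kappa>\<close>. A sequence is paired with its length,
  since elements of \<open>Func A B\<close> do not determine \<open>A\<close>.
\<close>

definition short_binary_seqs :: "'k rel \<Rightarrow> ('k \<times> ('k \<Rightarrow> bool)) set" where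
  "short_binary_seqs k = (SIGMA \<alpha>:Field k. Func (underS k \<alpha>) (UNIV :: bool set))"

definition admissible_cardinal :: "'k rel \<Rightarrow> bool" where
  "admissible_cardinal k \<longleftrightarrow>
     Card_order k \<and> natLeq <o k \<and> regularCard k \<and> |short_binary_seqs k| =o k"


definition coinitial_in :: "'g::linorder set \<Rightarrow> 'g set \<Rightarrow> bool" where
  "coinitial_in A P \<longleftrightarrow> A \<subseteq> P \<and> (\<forall>p\<in>P. \<exists>a\<in>A. a \<le> p)"

text \<open>\<open>Deg(\<G>) = \<kappa>\<close>, where the totally ordered Abelian group \<open>\<G>\<close> is the type \<open>'g\<close>.\<close>

definition Deg_eq :: "'g::linordered_ab_group_add itself \<Rightarrow> 'k rel \<Rightarrow> bool" where
  "Deg_eq _ k \<longleftrightarrow>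
     (\<exists>A::'g set. coinitial_in A {\<epsilon>. 0 < \<epsilon>} \<and> |A| =o k \<and>
        (\<forall>B::'g set. coinitial_in B {\<epsilon>. 0 < \<epsilon>} \<longrightarrow> |A| \<le>o |B| ))"


definition weight_le :: "'a topology \<Rightarrow> 'k rel \<Rightarrow> bool" where
  "weight_le X k \<longleftrightarrow>
     (\<exists>\<B>. |\<B>| \<le>o k \<and> (\<forall>V\<in>\<B>. openin X V) \<and>
        (\<forall>U x. openin X U \<and> x \<in> U \<longrightarrow> (\<exists>V\<in>\<B>. x \<in> V \<and> V \<subseteq> U)))"

definition card_additive :: "'k rel \<Rightarrow> 'a topology \<Rightarrow> bool" where
  "card_additive k X \<longleftrightarrow>
     (\<forall>\<U>. |\<U>| <o k \<and> (\<forall>U\<in>\<U>. openin X U) \<longrightarrow> openin X (topspace X \<inter> \<Inter>\<U>))"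

definition card_gdelta_in :: "'k rel \<Rightarrow> 'a topology \<Rightarrow> 'a set \<Rightarrow> bool" where
  "card_gdelta_in k X S \<longleftrightarrow>
     (\<exists>W. (\<forall>\<alpha>\<in>Field k. openin X (W \<alpha>)) \<and> S = topspace X \<inter> (\<Inter>\<alpha>\<in>Field k. W \<alpha>))"

definition supported_product_topology ::
    "'k rel \<Rightarrow> ('i \<Rightarrow> 'a topology) \<Rightarrow> 'i set \<Rightarrow> ('i \<Rightarrow> 'a) topology" where
  "supported_product_topology k X I =
     topology_generated_by
       {Pi\<^sub>E I U | U. (\<forall>i\<in>I. openin (X i) (U i)) \<and> |{i\<in>I. U i \<noteq> topspace (X i)}| <o k}"


definition G_metric_on :: "'a set \<Rightarrow> ('a \<Rightarrow> 'a \<Rightarrow> 'g::linordered_ab_group_add) \<Rightarrow> bool" where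
  "G_metric_on M d \<longleftrightarrow>
     (\<forall>x\<in>M. \<forall>y\<in>M. 0 \<le> d x y \<and> (d x y = 0 \<longleftrightarrow> x = y) \<and> d x y = d y x) \<and>
     (\<forall>x\<in>M. \<forall>y\<in>M. \<forall>z\<in>M. d x z \<le> d x y + d y z)"

definition G_metric_topology ::
    "'a set \<Rightarrow> ('a \<Rightarrow> 'a \<Rightarrow> 'g::linordered_ab_group_add) \<Rightarrow> 'a topology" where
  "G_metric_topology M d = topology_generated_by {{y\<in>M. d x y < \<epsilon>} | x \<epsilon>. x \<in> M \<and> 0 < \<epsilon>}"

definition G_Cauchy_seq ::
    "'k rel \<Rightarrow> ('a \<Rightarrow> 'a \<Rightarrow> 'g::linordered_ab_group_add) \<Rightarrow> ('k \<Rightarrow> 'a) \<Rightarrow> bool" where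
  "G_Cauchy_seq k d s \<longleftrightarrow>
     (\<forall>\<epsilon>>0. \<exists>\<alpha>\<in>Field k. \<forall>\<beta> \<gamma>. (\<alpha>, \<beta>) \<in> k \<and> (\<alpha>, \<gamma>) \<in> k \<longrightarrow> d (s \<beta>) (s \<gamma>) < \<epsilon>)"

definition G_converges ::
    "'k rel \<Rightarrow> ('a \<Rightarrow> 'a \<Rightarrow> 'g::linordered_ab_group_add) \<Rightarrow> ('k \<Rightarrow> 'a) \<Rightarrow> 'a \<Rightarrow> bool" where
  "G_converges k d s x \<longleftrightarrow>
     (\<forall>\<epsilon>>0. \<exists>\<alpha>\<in>Field k. \<forall>\<beta>. (\<alpha>, \<beta>) \<in> k \<longrightarrow> d (s \<beta>) x < \<epsilon>)"

definition G_Cauchy_complete ::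
    "'k rel \<Rightarrow> 'a set \<Rightarrow> ('a \<Rightarrow> 'a \<Rightarrow> 'g::linordered_ab_group_add) \<Rightarrow> bool" where
  "G_Cauchy_complete k M d \<longleftrightarrow>
     (\<forall>s. s ` Field k \<subseteq> M \<and> G_Cauchy_seq k d s \<longrightarrow> (\<exists>x\<in>M. G_converges k d s x))"

definition G_Polish ::
    "'g::linordered_ab_group_add itself \<Rightarrow> 'k rel \<Rightarrow> 'a topology \<Rightarrow> bool" where
  "G_Polish _ k X \<longleftrightarrow>
     regular_space X \<and> Hausdorff_space X \<and> weight_le X k \<and>
     (\<exists>d :: 'a \<Rightarrow> 'a \<Rightarrow> 'g. G_metric_on (topspace X) d \<and>
        X = G_metric_topology (topspace X) d \<and> G_Cauchy_complete k (topspace X) d)"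


text \<open>
  The strong fair Choquet game. A sequence \<open>m\<close> lists the moves \<open>m \<alpha> = (U\<^sub>\<alpha>, x\<^sub>\<alpha>)\<close> of player I. A
  strategy \<open>\<sigma>\<close> of player II is given at stage \<open>\<alpha>\<close> only the moves \<open>m \<beta>\<close> with \<open>\<beta> \<le> \<alpha>\<close>, because
  \<open>m\<close> is restricted to \<open>under k \<alpha>\<close>; the earlier moves of II are determined by these.
\<close>

definition II_moves ::
    "'k rel \<Rightarrow> ('k \<Rightarrow> ('k \<Rightarrow> 'a set \<times> 'a) \<Rightarrow> 'a set) \<Rightarrow> ('k \<Rightarrow> 'a set \<times> 'a) \<Rightarrow> 'k \<Rightarrow> 'a set" where
  "II_moves k \<sigma> m \<alpha> = \<sigma> \<alpha> (restrict m (under k \<alpha>))"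

definition position :: "'k rel \<Rightarrow> 'a topology \<Rightarrow> ('k \<Rightarrow> 'a set) \<Rightarrow> 'k \<Rightarrow> 'a set" where
  "position k X V \<alpha> = topspace X \<inter> (\<Inter>\<beta>\<in>underS k \<alpha>. V \<beta>)"

definition I_legal ::
    "'k rel \<Rightarrow> 'a topology \<Rightarrow> ('k \<Rightarrow> 'a set \<times> 'a) \<Rightarrow> ('k \<Rightarrow> 'a set) \<Rightarrow> 'k \<Rightarrow> bool" where
  "I_legal k X m V \<alpha> \<longleftrightarrow>
     openin (subtopology X (position k X V \<alpha>)) (fst (m \<alpha>)) \<and> snd (m \<alpha>) \<in> fst (m \<alpha>)"

definition II_legal ::
    "'k rel \<Rightarrow> 'a topology \<Rightarrow> ('k \<Rightarrow> 'a set \<times> 'a) \<Rightarrow> ('k \<Rightarrow> 'a set) \<Rightarrow> 'k \<Rightarrow> bool" where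
  "II_legal k X m V \<alpha> \<longleftrightarrow>
     openin (subtopology X (position k X V \<alpha>)) (V \<alpha>) \<and> snd (m \<alpha>) \<in> V \<alpha> \<and> V \<alpha> \<subseteq> fst (m \<alpha>)"

text \<open>
  Fairness: if the intersection of II's moves before a limit stage \<open>\<gamma> < \<kappa>\<close> is empty, then the run
  ends and II has won. In the formalization the position at \<open>\<gamma>\<close> is then empty, so that \<open>I_legal\<close>
  fails at \<open>\<gamma>\<close> and the second clause asks nothing of such a run. At zero and successor stages the
  position can be empty only if \<open>X\<close> is, since II's move contains I's point. Hence I is legal at all
  stages exactly in the runs that last \<open>\<kappa>\<close> rounds.
\<close>

definition II_winning_strategy ::
    "'k rel \<Rightarrow> 'a topology \<Rightarrow> ('k \<Rightarrow> ('k \<Rightarrow> 'a set \<times> 'a) \<Rightarrow> 'a set) \<Rightarrow> bool" where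
  "II_winning_strategy k X \<sigma> \<longleftrightarrow>
     (\<forall>m. let V = II_moves k \<sigma> m in
        (\<forall>\<alpha>\<in>Field k. (\<forall>\<beta>\<in>under k \<alpha>. I_legal k X m V \<beta>) \<longrightarrow> II_legal k X m V \<alpha>) \<and>
        ((\<forall>\<alpha>\<in>Field k. I_legal k X m V \<alpha>) \<longrightarrow> topspace X \<inter> (\<Inter>\<alpha>\<in>Field k. V \<alpha>) \<noteq> {}))"

definition fSC_space :: "'k rel \<Rightarrow> 'a topology \<Rightarrow> bool" where
  "fSC_space k X \<longleftrightarrow>
     regular_space X \<and> Hausdorff_space X \<and> weight_le X k \<and> (\<exists>\<sigma>. II_winning_strategy k X \<sigma>)"

end

theory Submission
  imports Defs
begin

text \<open>
  Everything is reduced to one combinatorial notion. A filtration of a space is a decreasing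
  sequence, indexed by the ordinals below \<open>\<kappa>\<close>, of partitions into open sets that together form a base
  and separate points; it is complete if every branch through it, that is every decreasing choice of
  one nonempty class per level, has a common point. Both descriptions of the class of spaces in
  question say exactly that the weight is at most \<open>\<kappa>\<close> and that there is a complete filtration
  (lemmas \<open>G_Polish_iff_complete_filtration\<close> and \<open>additive_fSC_iff_complete_filtration\<close>), and the
  closure properties are then proved for complete filtrations.

  From a metric to a filtration: as \<open>\<kappa>\<close> is uncountable and regular, below each \<open>\<epsilon> > 0\<close> there is a
  \<open>\<delta> > 0\<close> all of whose finite multiples stay below \<open>\<epsilon>\<close>. Hence the relation "every finite multiple of
  \<open>d x y\<close> is below \<open>\<epsilon>\<close>" is an equivalence relation with open classes, and running \<open>\<epsilon>\<close> through a sequence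
  coinitial in the positive elements gives the filtration. Conversely, such a sequence \<open>r\<close> turns a
  filtration into an ultrametric whose value at two distinct points is \<open>r \<delta>\<close> for the first level \<open>\<delta>\<close>
  that separates them.

  From a filtration to the game: player II answers \<open>(U, x)\<close> at stage \<open>\<alpha>\<close> with a class of \<open>x\<close> inside \<open>U\<close>
  of level at least \<open>\<alpha>\<close>. A run that lasts \<open>\<kappa>\<close> rounds is then a branch. Conversely, additivity and the
  weight yield some filtration \<open>N\<close>, which a winning strategy makes complete: by recursion on \<open>\<alpha>\<close> one
  builds partitions \<open>C \<alpha>\<close>, each refining the earlier ones and \<open>N \<alpha>\<close>, and attaches to each class a
  run of the game in which II's answers contain the corresponding classes. At stage \<open>\<alpha>\<close>, the
  intersection of the earlier classes of a point is open; each of its points, played by I together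
  with a neighbourhood, is covered by an answer of II, and this open cover is refined by a partition
  (lemma \<open>open_covers_refined_by_partition\<close>). A branch through these partitions is nonempty at all
  stages below \<open>\<kappa>\<close>, so its run is played to the end and II's victory provides the common point. This
  is where the fairness of the game matters: II promises nothing about branches that die at a limit
  stage, and completeness does not ask about them.

  The hypothesis \<open>2\<^sup><\<^sup>\<kappa> = \<kappa>\<close> enters through the weight of products: a class of the product filtration is
  determined by fewer than \<open>\<kappa>\<close> coordinates, and \<open>\<kappa>\<close> has only \<open>\<kappa>\<close> subsets of size less than \<open>\<kappa>\<close> (lemma
  \<open>card_of_small_subsets\<close>).
\<close>

section \<open>Ordinals below a regular uncountable cardinal\<close>

locale regular_uncountable =
  fixes k :: "'k rel"
  assumes Card_order: "Card_order k"
    and uncountable: "natLeq <o k"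
    and regular: "regularCard k"
begin

abbreviation le (infix "\<preceq>" 50) where "\<alpha> \<preceq> \<beta> \<equiv> (\<alpha>, \<beta>) \<in> k"

lemma Well_order: "Well_order k"
  using Card_order by (simp add: card_order_on_def)

lemma le_Field: "\<alpha> \<preceq> \<beta> \<Longrightarrow> \<alpha> \<in> Field k" "\<alpha> \<preceq> \<beta> \<Longrightarrow> \<beta> \<in> Field k"
  by (auto simp: Field_def)

lemma le_refl: "\<alpha> \<in> Field k \<Longrightarrow> \<alpha> \<preceq> \<alpha>"
  using Well_order by (meson wo_rel.REFL wo_rel_def refl_on_def)

lemma le_trans: "\<alpha> \<preceq> \<beta> \<Longrightarrow> \<beta> \<preceq> \<gamma> \<Longrightarrow> \<alpha> \<preceq> \<gamma>"
  using Well_order by (meson wo_rel.TRANS wo_rel_def transD)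

lemma le_total: "\<alpha> \<in> Field k \<Longrightarrow> \<beta> \<in> Field k \<Longrightarrow> \<alpha> \<preceq> \<beta> \<or> \<beta> \<preceq> \<alpha>"
  using Well_order by (meson wo_rel.TOTALS wo_rel_def)

lemma le_antisym: "\<alpha> \<preceq> \<beta> \<Longrightarrow> \<beta> \<preceq> \<alpha> \<Longrightarrow> \<alpha> = \<beta>"
  using Well_order by (meson wo_rel.ANTISYM wo_rel_def antisymD)

lemma underS_if_not_le: "\<alpha> \<in> Field k \<Longrightarrow> \<beta> \<in> Field k \<Longrightarrow> \<not> \<alpha> \<preceq> \<beta> \<Longrightarrow> \<beta> \<in> underS k \<alpha>"
  using le_total le_refl by (fastforce simp: underS_def)

lemma wf_less: "wf (k - Id)"
  using Well_order by (simp add: well_order_on_def)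

lemma least_exists:
  assumes "\<alpha> \<in> Field k" "P \<alpha>"
  shows "\<exists>\<delta>. \<delta> \<in> Field k \<and> P \<delta> \<and> (\<forall>\<beta>\<in>Field k. P \<beta> \<longrightarrow> \<delta> \<preceq> \<beta>)"
proof -
  obtain \<delta> where \<delta>: "\<delta> \<in> {\<alpha> \<in> Field k. P \<alpha>}"
    "\<And>\<beta>. (\<beta>, \<delta>) \<in> k - Id \<Longrightarrow> \<beta> \<notin> {\<alpha> \<in> Field k. P \<alpha>}"
    using wfE_min[OF wf_less, of \<alpha> "{\<alpha> \<in> Field k. P \<alpha>}"] assms by blast
  have "\<delta> \<preceq> \<beta>" if "\<beta> \<in> Field k" "P \<beta>" for \<beta>
  proof (rule ccontr)
    assume "\<not> \<delta> \<preceq> \<beta>"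
    then have "(\<beta>, \<delta>) \<in> k - Id"
      using underS_if_not_le[of \<delta> \<beta>] \<delta>(1) that(1) by (auto simp: underS_def)
    then show False
      using \<delta>(2) that by blast
  qed
  with \<delta>(1) show ?thesis by blast
qed

lemma infinite_Field: "infinite (Field k)"
proof
  assume "finite (Field k)"
  moreover have "|UNIV :: nat set| \<le>o k"
    using uncountable card_of_nat ordIso_ordLess_trans ordLess_imp_ordLeq by blast
  then have "|UNIV :: nat set| \<le>o |Field k|"
    using card_of_Field_ordIso[OF Card_order] ordIso_symmetric ordLeq_ordIso_trans by blast
  ultimately show False
    using card_of_ordLeq_finite infinite_UNIV_nat by blast
qed

lemma Field_nonempty: "Field k \<noteq> {}"
  using infinite_Field by auto

lemma card_of_Field: "|Field k| =o k"
  by (rule card_of_Field_ordIso[OF Card_order])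

lemma small_image: "|A| <o k \<Longrightarrow> |f ` A| <o k"
  using card_of_image ordLeq_ordLess_trans by blast

lemma small_subset: "|A| <o k \<Longrightarrow> B \<subseteq> A \<Longrightarrow> |B| <o k"
  using card_of_mono1 ordLeq_ordLess_trans by blast

lemma small_underS: "\<alpha> \<in> Field k \<Longrightarrow> |underS k \<alpha>| <o k"
  by (rule card_of_underS[OF Card_order])

lemma ex_greater: "\<alpha> \<in> Field k \<Longrightarrow> \<exists>\<beta>\<in>Field k. \<alpha> \<in> underS k \<beta>"
  using infinite_Card_order_limit[OF Card_order infinite_Field, of \<alpha>] by (auto simp: underS_def)

lemma small_under: "\<alpha> \<in> Field k \<Longrightarrow> |under k \<alpha>| <o k"
proof -
  assume "\<alpha> \<in> Field k"
  then obtain \<beta> where \<beta>: "\<beta> \<in> Field k" "\<alpha> \<in> underS k \<beta>"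
    using ex_greater by blast
  then have "under k \<alpha> \<subseteq> underS k \<beta>"
    using le_trans le_antisym by (auto simp: under_def underS_def)
  with small_underS[OF \<beta>(1)] show ?thesis
    by (rule small_subset)
qed

lemma small_range_nat: "|range (f :: nat \<Rightarrow> 'c)| <o k"
proof -
  have "|UNIV :: nat set| <o k"
    using uncountable card_of_nat ordIso_ordLess_trans by blast
  then show ?thesis by (rule small_image)
qed

lemma small_bounded:
  assumes "|A| <o k" "f ` A \<subseteq> Field k"
  shows "\<exists>\<beta>\<in>Field k. \<forall>a\<in>A. f a \<preceq> \<beta>"
proof -
  have "\<not> |f ` A| =o k"
    using small_image[OF assms(1)] not_ordLess_ordIso by blast
  then have "\<not> cofinal (f ` A) k"
    using regular assms(2) by (auto simp: regularCard_def)
  then obtain \<beta> where "\<beta> \<in> Field k" "\<forall>a\<in>A. \<not> (\<beta> \<noteq> f a \<and> \<beta> \<preceq> f a)"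
    by (auto simp: cofinal_def)
  then show ?thesis
    using le_total le_refl assms(2) by (metis image_subset_iff)
qed

lemma ex_upper_bound:
  assumes "\<alpha> \<in> Field k" "\<beta> \<in> Field k"
  shows "\<exists>\<gamma>\<in>Field k. \<alpha> \<preceq> \<gamma> \<and> \<beta> \<preceq> \<gamma>"
  using assms le_total le_refl by meson

lemma coding_exists:
  assumes "|A| \<le>o k"
  shows "\<exists>c. inj_on c A \<and> c ` A \<subseteq> Field k"
proof -
  have "|A| \<le>o |Field k|"
    using assms card_of_Field ordIso_symmetric ordLeq_ordIso_trans by blast
  then show ?thesis by (simp add: card_of_ordLeq)
qed

lemma card_of_le_times: "|A| \<le>o k \<Longrightarrow> |B| \<le>o k \<Longrightarrow> |A \<times> B| \<le>o k"
  by (rule card_of_Times_ordLeq_infinite_Field[OF infinite_Field _ _ Card_order])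

lemma card_of_Field_le: "|Field k| \<le>o k"
  using card_of_Field ordIso_imp_ordLeq by blast

text \<open>
  By regularity a subset of \<open>\<kappa>\<close> of size \<open>< \<kappa>\<close> is bounded, and is
  therefore determined by a bound together with its characteristic function below that bound; and of
  such functions there are only \<open>2\<^sup><\<^sup>\<kappa> = \<kappa>\<close> many.
\<close>

lemma card_of_small_subsets:
  assumes "|short_binary_seqs k| =o k"
  shows "|{A. A \<subseteq> Field k \<and> |A| <o k}| \<le>o k"
proof -
  let ?S = "{A. A \<subseteq> Field k \<and> |A| <o k}"
  have "\<exists>\<delta>. \<delta> \<in> Field k \<and> A \<subseteq> underS k \<delta>" if A: "A \<in> ?S" for A
  proof -
    obtain \<beta> where \<beta>: "\<beta> \<in> Field k" "\<forall>a\<in>A. a \<preceq> \<beta>"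
      using A small_bounded[of A "\<lambda>a. a"] by auto
    obtain \<delta> where \<delta>: "\<delta> \<in> Field k" "\<beta> \<in> underS k \<delta>"
      using ex_greater \<beta>(1) by blast
    have "A \<subseteq> underS k \<delta>"
      using \<beta> \<delta> le_trans le_antisym by (fastforce simp: underS_def)
    with \<delta>(1) show ?thesis by blast
  qed
  then have "\<forall>A\<in>?S. \<exists>\<delta>. \<delta> \<in> Field k \<and> A \<subseteq> underS k \<delta>"
    by (rule ballI)
  from bchoice[OF this]
  obtain \<delta> where \<delta>: "\<forall>A\<in>?S. \<delta> A \<in> Field k \<and> A \<subseteq> underS k (\<delta> A)"
    by (rule exE)
  define h where "h A = (\<delta> A, \<lambda>x. if x \<in> underS k (\<delta> A) then x \<in> A else undefined)" for A
  have "h ` ?S \<subseteq> short_binary_seqs k"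
    using \<delta> by (auto simp: h_def short_binary_seqs_def Func_def)
  moreover have "inj_on h ?S"
  proof (rule inj_onI)
    fix A B assume A: "A \<in> ?S" and B: "B \<in> ?S" and eq: "h A = h B"
    have "x \<in> A \<longleftrightarrow> x \<in> B" if "x \<in> underS k (\<delta> A)" for x
      using eq that by (auto simp: h_def dest: fun_cong[of _ _ x])
    moreover have "\<delta> B = \<delta> A"
      using eq by (simp add: h_def)
    ultimately show "A = B"
      using bspec[OF \<delta> A] bspec[OF \<delta> B] by auto
  qed
  ultimately have "|?S| \<le>o |short_binary_seqs k|"
    using card_of_ordLeq by blast
  then show ?thesis
    using assms ordLeq_ordIso_trans by blast
qed

end

section \<open>Complete filtrations\<close>

text \<open>
  A point \<open>s \<alpha>\<close> stands for its class \<open>N \<alpha> (s \<alpha>)\<close>, so that the sequences \<open>s\<close> quantified here are the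
  branches through \<open>N\<close> whose classes are all nonempty.
\<close>

definition complete_filtration ::
    "'k rel \<Rightarrow> 'a topology \<Rightarrow> ('k \<Rightarrow> 'a \<Rightarrow> 'a set) \<Rightarrow> bool" where
  "complete_filtration k X N \<longleftrightarrow>
    (\<forall>s. (\<forall>\<alpha>\<in>Field k. s \<alpha> \<in> topspace X) \<and> (\<forall>\<alpha> \<beta>. (\<alpha>, \<beta>) \<in> k \<longrightarrow> s \<beta> \<in> N \<alpha> (s \<alpha>)) \<longrightarrow>
       (\<exists>x\<in>topspace X. \<forall>\<alpha>\<in>Field k. x \<in> N \<alpha> (s \<alpha>)))"

text \<open>
  The set \<open>N \<alpha> x\<close> is the class of \<open>x\<close> in the partition of level \<open>\<alpha>\<close>.
\<close>

locale filtration = regular_uncountable k for k :: "'k rel" +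
  fixes X :: "'a topology" and N :: "'k \<Rightarrow> 'a \<Rightarrow> 'a set"
  assumes mem_class: "\<And>\<alpha> x. \<alpha> \<in> Field k \<Longrightarrow> x \<in> topspace X \<Longrightarrow> x \<in> N \<alpha> x"
    and open_class: "\<And>\<alpha> x. \<alpha> \<in> Field k \<Longrightarrow> x \<in> topspace X \<Longrightarrow> openin X (N \<alpha> x)"
    and class_eq: "\<And>\<alpha> x y. \<alpha> \<in> Field k \<Longrightarrow> x \<in> topspace X \<Longrightarrow> y \<in> N \<alpha> x \<Longrightarrow> N \<alpha> y = N \<alpha> x"
    and class_anti: "\<And>\<alpha> \<beta> x. \<alpha> \<preceq> \<beta> \<Longrightarrow> x \<in> topspace X \<Longrightarrow> N \<beta> x \<subseteq> N \<alpha> x"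
    and class_base: "\<And>U x. openin X U \<Longrightarrow> x \<in> U \<Longrightarrow> \<exists>\<alpha>\<in>Field k. N \<alpha> x \<subseteq> U"
    and separated: "\<And>x y. x \<in> topspace X \<Longrightarrow> y \<in> topspace X \<Longrightarrow> (\<forall>\<alpha>\<in>Field k. y \<in> N \<alpha> x) \<Longrightarrow> x = y"
begin

lemma class_sub: "\<alpha> \<in> Field k \<Longrightarrow> x \<in> topspace X \<Longrightarrow> N \<alpha> x \<subseteq> topspace X"
  using open_class openin_subset by blast

lemma class_sym: "\<alpha> \<in> Field k \<Longrightarrow> x \<in> topspace X \<Longrightarrow> y \<in> N \<alpha> x \<Longrightarrow> x \<in> N \<alpha> y"
  using class_eq mem_class by blast

lemma class_base_above:
  assumes "openin X U" "x \<in> U" "\<alpha> \<in> Field k"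
  shows "\<exists>\<delta>\<in>Field k. \<alpha> \<preceq> \<delta> \<and> N \<delta> x \<subseteq> U"
proof -
  obtain \<beta> where "\<beta> \<in> Field k" "N \<beta> x \<subseteq> U"
    using class_base assms by blast
  moreover obtain \<delta> where "\<delta> \<in> Field k" "\<alpha> \<preceq> \<delta>" "\<beta> \<preceq> \<delta>"
    using ex_upper_bound calculation(1) assms(3) by blast
  moreover have "x \<in> topspace X"
    using assms openin_subset by blast
  ultimately show ?thesis
    using class_anti by blast
qed

lemma closed_class:
  assumes "\<alpha> \<in> Field k" "x \<in> topspace X"
  shows "closedin X (N \<alpha> x)"
proof -
  have "\<exists>T. openin X T \<and> y \<in> T \<and> T \<subseteq> topspace X - N \<alpha> x" if "y \<in> topspace X - N \<alpha> x" for y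
  proof (intro exI conjI)
    show "openin X (N \<alpha> y)" "y \<in> N \<alpha> y"
      using that assms open_class mem_class by auto
    show "N \<alpha> y \<subseteq> topspace X - N \<alpha> x"
    proof
      fix z assume z: "z \<in> N \<alpha> y"
      then have "z \<in> N \<alpha> x \<Longrightarrow> y \<in> N \<alpha> x"
        using that assms class_eq[of \<alpha> x z] class_sym[of \<alpha> y z] by auto
      then show "z \<in> topspace X - N \<alpha> x"
        using that assms class_sub[of \<alpha> y] z by auto
    qed
  qed
  then have "openin X (topspace X - N \<alpha> x)"
    by (subst openin_subopen) (rule ballI)
  then show ?thesis
    using class_sub[OF assms] by (simp add: closedin_def)
qed

lemma regular_space: "regular_space X"
  unfolding regular_space_def
proof (intro allI impI, elim conjE)
  fix C a assume C: "closedin X C" and a: "a \<in> topspace X - C"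
  then obtain \<alpha> where \<alpha>: "\<alpha> \<in> Field k" "N \<alpha> a \<subseteq> topspace X - C"
    using class_base[of "topspace X - C" a] by blast
  have aX: "a \<in> topspace X"
    using a by blast
  show "\<exists>U V. openin X U \<and> openin X V \<and> a \<in> U \<and> C \<subseteq> V \<and> disjnt U V"
  proof (intro exI conjI)
    show "openin X (N \<alpha> a)" "a \<in> N \<alpha> a"
      using \<alpha>(1) aX open_class mem_class by auto
    show "openin X (topspace X - N \<alpha> a)"
      using closed_class[OF \<alpha>(1) aX] by blast
    show "C \<subseteq> topspace X - N \<alpha> a" "disjnt (N \<alpha> a) (topspace X - N \<alpha> a)"
      using \<alpha>(2) closedin_subset[OF C] by (auto simp: disjnt_def)
  qed
qed

lemma Hausdorff_space: "Hausdorff_space X"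
  unfolding Hausdorff_space_def
proof (intro allI impI, elim conjE)
  fix x y assume xy: "x \<in> topspace X" "y \<in> topspace X" "x \<noteq> y"
  then obtain \<alpha> where \<alpha>: "\<alpha> \<in> Field k" "y \<notin> N \<alpha> x"
    using separated by blast
  show "\<exists>U V. openin X U \<and> openin X V \<and> x \<in> U \<and> y \<in> V \<and> disjnt U V"
  proof (intro exI conjI)
    show "openin X (N \<alpha> x)" "x \<in> N \<alpha> x"
      using \<alpha>(1) xy open_class mem_class by auto
    show "openin X (topspace X - N \<alpha> x)"
      using closed_class[OF \<alpha>(1) xy(1)] by blast
    show "y \<in> topspace X - N \<alpha> x" "disjnt (N \<alpha> x) (topspace X - N \<alpha> x)"
      using \<alpha>(2) xy by (auto simp: disjnt_def)
  qed
qed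

text \<open>
  Fewer than \<open>\<kappa>\<close> neighbourhoods of \<open>x\<close> contain classes of \<open>x\<close> whose levels are bounded by regularity.
\<close>

lemma additive: "card_additive k X"
  unfolding card_additive_def
proof (intro allI impI, elim conjE)
  fix \<U> assume small: "|\<U>| <o k" and op: "\<forall>U\<in>\<U>. openin X U"
  have "\<exists>T. openin X T \<and> x \<in> T \<and> T \<subseteq> topspace X \<inter> \<Inter>\<U>" if x: "x \<in> topspace X \<inter> \<Inter>\<U>" for x
  proof -
    have "\<forall>U\<in>\<U>. \<exists>\<alpha>\<in>Field k. N \<alpha> x \<subseteq> U"
      using op x class_base by blast
    then obtain f where f: "\<forall>U\<in>\<U>. f U \<in> Field k \<and> N (f U) x \<subseteq> U"
      by metis
    then obtain \<beta> where \<beta>: "\<beta> \<in> Field k" "\<forall>U\<in>\<U>. f U \<preceq> \<beta>"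
      using small_bounded[OF small, of f] by blast
    have xX: "x \<in> topspace X"
      using x by blast
    have "N \<beta> x \<subseteq> U" if "U \<in> \<U>" for U
      using that f \<beta>(2) class_anti[of "f U" \<beta> x] xX by blast
    then have "N \<beta> x \<subseteq> topspace X \<inter> \<Inter>\<U>"
      using class_sub[OF \<beta>(1) xX] by blast
    then show ?thesis
      using open_class[OF \<beta>(1) xX] mem_class[OF \<beta>(1) xX] by blast
  qed
  then show "openin X (topspace X \<inter> \<Inter>\<U>)"
    by (subst openin_subopen) (rule ballI)
qed

text \<open>
  A bound on the weight amounts to naming the classes of each level by ordinals below \<open>\<kappa>\<close>; a point
  may use any name that only its own class uses.
\<close>

lemma weight_le_if_classes_coded:
  assumes "|Z| \<le>o k"
    and "\<And>\<alpha>. \<alpha> \<in> Field k \<Longrightarrow> c \<alpha> ` topspace X \<subseteq> Z"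
    and "\<And>\<alpha> x y. \<alpha> \<in> Field k \<Longrightarrow> x \<in> topspace X \<Longrightarrow> y \<in> topspace X \<Longrightarrow> c \<alpha> x = c \<alpha> y \<Longrightarrow> y \<in> N \<alpha> x"
  shows "weight_le X k"
proof -
  define \<B> where "\<B> = (\<lambda>(\<alpha>, x). N \<alpha> x) ` (Field k \<times> topspace X)"
  define g where "g = (\<lambda>(\<alpha>, z). N \<alpha> (SOME x. x \<in> topspace X \<and> c \<alpha> x = z))"
  have "\<B> \<subseteq> g ` (Field k \<times> Z)"
  proof
    fix B assume "B \<in> \<B>"
    then obtain \<alpha> x where \<alpha>: "\<alpha> \<in> Field k" and x: "x \<in> topspace X" and B: "B = N \<alpha> x"
      by (auto simp: \<B>_def)
    let ?y = "SOME y. y \<in> topspace X \<and> c \<alpha> y = c \<alpha> x"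
    have "?y \<in> topspace X \<and> c \<alpha> ?y = c \<alpha> x"
      by (rule someI[of _ x]) (use x in simp)
    then have "N \<alpha> ?y = N \<alpha> x"
      using assms(3) \<alpha> x class_eq by metis
    then have "B = g (\<alpha>, c \<alpha> x)"
      by (simp add: g_def B)
    then show "B \<in> g ` (Field k \<times> Z)"
      using \<alpha> x assms(2) by blast
  qed
  then have "|\<B>| \<le>o |Field k \<times> Z|"
    using surj_imp_ordLeq by blast
  also have "|Field k \<times> Z| \<le>o k"
    using card_of_le_times card_of_Field_le assms(1) by blast
  finally have "|\<B>| \<le>o k" .
  moreover have "\<forall>V\<in>\<B>. openin X V"
    using open_class by (auto simp: \<B>_def)
  moreover have "\<exists>V\<in>\<B>. x \<in> V \<and> V \<subseteq> U" if "openin X U" "x \<in> U" for U x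
  proof -
    obtain \<alpha> where "\<alpha> \<in> Field k" "N \<alpha> x \<subseteq> U"
      using class_base \<open>openin X U\<close> \<open>x \<in> U\<close> by blast
    moreover have "x \<in> topspace X"
      using that openin_subset by blast
    ultimately have "N \<alpha> x \<in> \<B>" "x \<in> N \<alpha> x"
      using mem_class by (auto simp: \<B>_def)
    with \<open>N \<alpha> x \<subseteq> U\<close> show ?thesis
      by blast
  qed
  ultimately show ?thesis
    unfolding weight_le_def by blast
qed

text \<open>
  A point is named by a member of the base that contains it and lies inside its class.
\<close>

lemma classes_coded_if_weight_le:
  assumes "weight_le X k"
  shows "\<exists>c. \<forall>\<alpha>\<in>Field k. c \<alpha> ` topspace X \<subseteq> Field k \<and>
    (\<forall>x\<in>topspace X. \<forall>y\<in>topspace X. c \<alpha> x = c \<alpha> y \<longrightarrow> y \<in> N \<alpha> x)"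
proof -
  from assms obtain \<B> where "|\<B>| \<le>o k"
    and "\<forall>U x. openin X U \<and> x \<in> U \<longrightarrow> (\<exists>V\<in>\<B>. x \<in> V \<and> V \<subseteq> U)"
    unfolding weight_le_def by (elim exE conjE) (rule that)
  then have \<B>: "|\<B>| \<le>o k" "\<And>U x. openin X U \<Longrightarrow> x \<in> U \<Longrightarrow> \<exists>V\<in>\<B>. x \<in> V \<and> V \<subseteq> U"
    by blast+
  obtain b where b: "inj_on b \<B>" "b ` \<B> \<subseteq> Field k"
    using coding_exists[OF \<B>(1)] by blast
  have "\<forall>\<alpha> x. \<exists>V. \<alpha> \<in> Field k \<longrightarrow> x \<in> topspace X \<longrightarrow> V \<in> \<B> \<and> x \<in> V \<and> V \<subseteq> N \<alpha> x"
  proof (intro allI)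
    fix \<alpha> x
    show "\<exists>V. \<alpha> \<in> Field k \<longrightarrow> x \<in> topspace X \<longrightarrow> V \<in> \<B> \<and> x \<in> V \<and> V \<subseteq> N \<alpha> x"
      using \<B>(2)[of "N \<alpha> x" x] open_class mem_class by blast
  qed
  then obtain V where V: "\<And>\<alpha> x. \<alpha> \<in> Field k \<Longrightarrow> x \<in> topspace X \<Longrightarrow>
      V \<alpha> x \<in> \<B> \<and> x \<in> V \<alpha> x \<and> V \<alpha> x \<subseteq> N \<alpha> x"
    by metis
  have "y \<in> N \<alpha> x" if "\<alpha> \<in> Field k" "x \<in> topspace X" "y \<in> topspace X" "b (V \<alpha> x) = b (V \<alpha> y)" for \<alpha> x y
  proof -
    have "V \<alpha> x = V \<alpha> y"
      by (rule inj_onD[OF b(1)]) (use that V in auto)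
    then show ?thesis
      using V[OF that(1,2)] V[OF that(1,3)] by blast
  qed
  moreover have "b (V \<alpha> x) \<in> Field k" if "\<alpha> \<in> Field k" "x \<in> topspace X" for \<alpha> x
    using that V b(2) by blast
  ultimately show ?thesis
    by (intro exI[of _ "\<lambda>\<alpha> x. b (V \<alpha> x)"]) auto
qed

end

section \<open>Filtrations and metrics with values in an ordered group\<close>

context regular_uncountable
begin

text \<open>
  A coinitial set of size less than \<open>\<kappa>\<close> would contradict that the coinitiality is \<open>\<kappa>\<close>.
\<close>

lemma small_positive_set_bounded_below:
  fixes B :: "'g::linordered_ab_group_add set"
  assumes "Deg_eq TYPE('g) k" "|B| <o k" "\<forall>b\<in>B. 0 < b"
  shows "\<exists>\<epsilon>>0. \<forall>b\<in>B. \<epsilon> < b"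
proof -
  obtain A :: "'g set" where A: "|A| =o k" "\<forall>B::'g set. coinitial_in B {\<epsilon>. 0 < \<epsilon>} \<longrightarrow> |A| \<le>o |B|"
    using assms(1) by (auto simp: Deg_eq_def)
  have "\<not> coinitial_in B {\<epsilon>. 0 < \<epsilon>}"
  proof
    assume "coinitial_in B {\<epsilon>. 0 < \<epsilon>}"
    then have "|A| \<le>o |B|" using A(2) by blast
    then have "k \<le>o |B|" using A(1) ordIso_symmetric ordIso_ordLeq_trans by blast
    then show False using assms(2) not_ordLess_ordLeq by blast
  qed
  then show ?thesis
    using assms(3) by (auto simp: coinitial_in_def linorder_not_le)
qed

text \<open>
  A coinitial set of size \<open>\<kappa>\<close> is enumerated by the ordinals below \<open>\<kappa>\<close>; recursion makes it strictly
  decreasing, as the fewer than \<open>\<kappa>\<close> values chosen so far have a positive lower bound.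
\<close>

lemma scale_exists:
  assumes deg: "Deg_eq TYPE('g::linordered_ab_group_add) k"
  obtains r :: "'k \<Rightarrow> 'g::linordered_ab_group_add" where "\<And>\<alpha>. \<alpha> \<in> Field k \<Longrightarrow> 0 < r \<alpha>"
    and "\<And>\<alpha> \<beta>. \<alpha> \<in> Field k \<Longrightarrow> \<beta> \<in> underS k \<alpha> \<Longrightarrow> r \<alpha> < r \<beta>"
    and "\<And>\<epsilon>. 0 < \<epsilon> \<Longrightarrow> \<exists>\<alpha>\<in>Field k. r \<alpha> \<le> \<epsilon>"
proof -
  obtain A :: "'g set" where A: "coinitial_in A {\<epsilon>. 0 < \<epsilon>}" "|A| =o k"
    using deg by (auto simp: Deg_eq_def)
  have "|Field k| =o |A|"
    using card_of_Field A(2) ordIso_symmetric ordIso_transitive by blast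
  then obtain a where a: "bij_betw a (Field k) A"
    using card_of_ordIso by blast
  have "\<exists>r :: 'k \<Rightarrow> 'g. \<forall>\<alpha>. \<alpha> \<in> Field k \<longrightarrow> 0 < r \<alpha> \<and> r \<alpha> \<le> a \<alpha> \<and> (\<forall>\<beta>\<in>underS k \<alpha>. r \<alpha> < r \<beta>)"
  proof (rule dependent_wf_choice[OF wf_less, where P = "\<lambda>r \<alpha> v. \<alpha> \<in> Field k \<longrightarrow>
        0 < v \<and> v \<le> a \<alpha> \<and> (\<forall>\<beta>\<in>underS k \<alpha>. v < r \<beta>)"], goal_cases)
    case (1 f g x r)
    have "f \<beta> = g \<beta>" if "\<beta> \<in> underS k x" for \<beta>
      using 1[of \<beta>] that by (auto simp: underS_def)
    then show ?case by simp
  next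
    case (2 \<alpha> r)
    have "\<forall>b \<in> insert (a \<alpha>) (r ` underS k \<alpha>). 0 < b" if \<alpha>: "\<alpha> \<in> Field k"
    proof
      fix b assume "b \<in> insert (a \<alpha>) (r ` underS k \<alpha>)"
      then consider "b = a \<alpha>" | \<beta> where "\<beta> \<in> underS k \<alpha>" "b = r \<beta>"
        by blast
      then show "0 < b"
      proof cases
        case 1
        then show ?thesis
          using A(1) a \<alpha> by (auto simp: coinitial_in_def bij_betw_def)
      next
        case b: 2
        then show ?thesis
          using 2[of \<beta>] le_Field by (auto simp: underS_def)
      qed
    qed
    moreover have "|insert (a \<alpha>) (r ` underS k \<alpha>)| <o k" if \<alpha>: "\<alpha> \<in> Field k"
    proof (rule small_subset[OF small_image[OF small_under[OF \<alpha>]]])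
      show "insert (a \<alpha>) (r ` underS k \<alpha>) \<subseteq> (\<lambda>\<beta>. if \<beta> = \<alpha> then a \<alpha> else r \<beta>) ` under k \<alpha>"
        using le_refl[OF \<alpha>] by (auto simp: under_def underS_def image_iff)
    qed
    ultimately have "\<exists>\<epsilon>>0. \<forall>b\<in>insert (a \<alpha>) (r ` underS k \<alpha>). \<epsilon> < b" if "\<alpha> \<in> Field k"
      using small_positive_set_bounded_below[OF deg] that by blast
    then show ?case
      by (meson image_eqI insertCI order_less_imp_le)
  qed
  then obtain r :: "'k \<Rightarrow> 'g" where r: "\<And>\<alpha>. \<alpha> \<in> Field k \<Longrightarrow> 0 < r \<alpha> \<and> r \<alpha> \<le> a \<alpha> \<and> (\<forall>\<beta>\<in>underS k \<alpha>. r \<alpha> < r \<beta>)"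
    by auto
  show ?thesis
  proof (rule that)
    show "\<exists>\<alpha>\<in>Field k. r \<alpha> \<le> \<epsilon>" if \<epsilon>: "0 < \<epsilon>" for \<epsilon>
    proof -
      obtain b where "b \<in> A" "b \<le> \<epsilon>"
        using A(1) \<epsilon> by (auto simp: coinitial_in_def)
      then obtain \<alpha> where "\<alpha> \<in> Field k" "a \<alpha> \<le> \<epsilon>"
        using a by (auto simp: bij_betw_def)
      then show ?thesis
        using r order_trans by blast
    qed
  qed (use r in auto)
qed

end

lemma openin_G_metric_topology:
  fixes d :: "'a \<Rightarrow> 'a \<Rightarrow> 'g::linordered_ab_group_add"
  assumes "G_metric_on M d"
  shows "openin (G_metric_topology M d) U \<longleftrightarrow> U \<subseteq> M \<and> (\<forall>x\<in>U. \<exists>\<epsilon>>0. {y\<in>M. d x y < \<epsilon>} \<subseteq> U)"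
    (is "_ \<longleftrightarrow> ?R U")
proof
  assume "openin (G_metric_topology M d) U"
  then have "generate_topology_on {{y\<in>M. d x y < \<epsilon>} | x \<epsilon>. x \<in> M \<and> 0 < \<epsilon>} U"
    by (simp add: G_metric_topology_def openin_topology_generated_by_iff)
  then show "?R U"
  proof induction
    case (Int U V)
    have "\<exists>\<epsilon>>0. {y\<in>M. d x y < \<epsilon>} \<subseteq> U \<inter> V" if x: "x \<in> U \<inter> V" for x
    proof -
      obtain \<epsilon> \<eta> where "0 < \<epsilon>" "{y\<in>M. d x y < \<epsilon>} \<subseteq> U" "0 < \<eta>" "{y\<in>M. d x y < \<eta>} \<subseteq> V"
        using Int x by blast
      then show ?thesis
        by (intro exI[of _ "min \<epsilon> \<eta>"]) auto
    qed
    with Int show ?case by blast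
  next
    case (UN K)
    then show ?case by (simp add: subset_iff Union_iff) meson
  next
    case (Basis B)
    then obtain x \<epsilon> where x: "x \<in> M" "0 < \<epsilon>" and B: "B = {y\<in>M. d x y < \<epsilon>}"
      by blast
    have "\<exists>\<eta>>0. {z\<in>M. d y z < \<eta>} \<subseteq> B" if y: "y \<in> B" for y
    proof (intro exI conjI)
      show "0 < \<epsilon> - d x y"
        using y by (simp add: B)
      show "{z\<in>M. d y z < \<epsilon> - d x y} \<subseteq> B"
      proof
        fix z assume z: "z \<in> {z\<in>M. d y z < \<epsilon> - d x y}"
        have "d x z \<le> d x y + d y z"
          using assms x y z by (simp add: G_metric_on_def B)
        also have "\<dots> < \<epsilon>"
          using z by (simp add: less_diff_eq add.commute)
        finally show "z \<in> B"
          using z by (simp add: B)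
      qed
    qed
    then show ?case
      by (auto simp: B)
  qed auto
next
  assume R: "?R U"
  have "\<exists>T. openin (G_metric_topology M d) T \<and> x \<in> T \<and> T \<subseteq> U" if x: "x \<in> U" for x
  proof -
    obtain \<epsilon> where \<epsilon>: "0 < \<epsilon>" "{y\<in>M. d x y < \<epsilon>} \<subseteq> U"
      using R x by blast
    have "openin (G_metric_topology M d) {y\<in>M. d x y < \<epsilon>}"
      unfolding G_metric_topology_def
      by (rule topology_generated_by_Basis) (use R x \<epsilon> in blast)
    moreover have "d x x = 0" "x \<in> M"
      using assms R x by (auto simp: G_metric_on_def)
    ultimately show ?thesis
      using \<epsilon> by (intro exI[of _ "{y\<in>M. d x y < \<epsilon>}"]) simp
  qed
  then show "openin (G_metric_topology M d) U"
    by (subst openin_subopen) (rule ballI)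
qed

text \<open>
  This is \<open>2\<^sup>n \<cdot> \<epsilon>\<close>. A bound on these for all \<open>n\<close> bounds all finite multiples of a positive \<open>\<epsilon>\<close>, and
  doubling suits the triangle inequality: the sum of two elements is at most twice the larger one.
\<close>

definition iterated_double :: "nat \<Rightarrow> 'g::linordered_ab_group_add \<Rightarrow> 'g" where
  "iterated_double n \<epsilon> = ((\<lambda>e. e + e) ^^ n) \<epsilon>"

lemma iterated_double_0 [simp]: "iterated_double 0 \<epsilon> = \<epsilon>"
  by (simp add: iterated_double_def)

lemma iterated_double_Suc: "iterated_double (Suc n) \<epsilon> = iterated_double n (\<epsilon> + \<epsilon>)"
  by (simp add: iterated_double_def funpow_Suc_right del: funpow.simps)

lemma iterated_double_zero [simp]: "iterated_double n 0 = 0"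
  by (induction n) (simp_all add: iterated_double_Suc)

lemma iterated_double_mono: "\<delta> \<le> \<epsilon> \<Longrightarrow> iterated_double n \<delta> \<le> iterated_double n \<epsilon>"
  by (induction n arbitrary: \<delta> \<epsilon>) (simp_all add: iterated_double_Suc add_mono)

context regular_uncountable
begin

text \<open>
  A positive \<open>\<eta> < \<epsilon>\<close> exists since \<open>{\<epsilon>}\<close> is not coinitial, and the smaller of \<open>\<eta>\<close> and
  \<open>\<epsilon> - \<eta>\<close> serves as \<open>\<delta>\<close>.
\<close>

lemma half_exists:
  assumes "Deg_eq TYPE('g::linordered_ab_group_add) k" "(0::'g) < \<epsilon>"
  shows "\<exists>\<delta>>0. \<delta> + \<delta> \<le> \<epsilon>"
proof -
  have "range (\<lambda>n::nat. \<epsilon>) = {\<epsilon>}" by auto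
  then have "|{\<epsilon>}| <o k"
    using small_range_nat[of "\<lambda>n. \<epsilon>"] by simp
  then obtain \<eta> where \<eta>: "0 < \<eta>" "\<eta> < \<epsilon>"
    using small_positive_set_bounded_below[OF assms(1), of "{\<epsilon>}"] assms(2) by auto
  have "min \<eta> (\<epsilon> - \<eta>) + min \<eta> (\<epsilon> - \<eta>) \<le> \<eta> + (\<epsilon> - \<eta>)"
    by (rule add_mono) auto
  then show ?thesis
    using \<eta> by (intro exI[of _ "min \<eta> (\<epsilon> - \<eta>)"]) auto
qed

lemma iterated_double_small:
  assumes deg: "Deg_eq TYPE('g::linordered_ab_group_add) k"
  shows "(0::'g) < \<epsilon> \<Longrightarrow> \<exists>\<delta>>0. iterated_double n \<delta> \<le> \<epsilon>"
proof (induction n)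
  case (Suc n)
  then obtain \<delta> where \<delta>: "0 < \<delta>" "iterated_double n \<delta> \<le> \<epsilon>"
    by blast
  obtain \<eta> where "0 < \<eta>" "\<eta> + \<eta> \<le> \<delta>"
    using half_exists[OF deg \<delta>(1)] by blast
  then show ?case
    using iterated_double_mono[of "\<eta> + \<eta>" \<delta> n] \<delta>(2)
    by (intro exI[of _ \<eta>]) (auto simp: iterated_double_Suc)
qed auto

text \<open>
  Uncountability of \<open>\<kappa>\<close> is used here: one \<open>\<delta>\<close> lies below countably many bounds, one for each \<open>n\<close>. This
  is what fails for real-valued metrics, and what makes the topology zero-dimensional.
\<close>

lemma infinitesimal_exists:
  assumes deg: "Deg_eq TYPE('g::linordered_ab_group_add) k" and \<epsilon>: "(0::'g) < \<epsilon>"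
  shows "\<exists>\<delta>>0. \<forall>n. iterated_double n \<delta> < \<epsilon>"
proof -
  obtain \<eta> where \<eta>: "0 < \<eta>" "\<eta> + \<eta> \<le> \<epsilon>"
    using half_exists[OF deg \<epsilon>] by blast
  have "\<forall>n. \<exists>\<delta>>0. iterated_double n \<delta> \<le> \<eta>"
    using iterated_double_small[OF deg \<eta>(1)] by blast
  then obtain f where f: "\<And>n. 0 < f n" "\<And>n. iterated_double n (f n) \<le> \<eta>"
    by metis
  obtain \<delta> where \<delta>: "0 < \<delta>" "\<forall>b\<in>range f. \<delta> < b"
    using small_positive_set_bounded_below[OF deg small_range_nat, of f] f(1) by auto
  have "iterated_double n \<delta> < \<epsilon>" for n
  proof -
    have "iterated_double n \<delta> \<le> iterated_double n (f n)"
      using \<delta>(2) by (intro iterated_double_mono) (simp add: less_imp_le)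
    also have "\<dots> \<le> \<eta>" by (rule f(2))
    also have "\<dots> < \<eta> + \<eta>" using \<eta>(1) by simp
    also have "\<dots> \<le> \<epsilon>" by (rule \<eta>(2))
    finally show ?thesis .
  qed
  with \<delta>(1) show ?thesis by blast
qed

text \<open>
  The elements all of whose finite multiples are below \<open>r \<alpha>\<close> form, with their negatives, a convex
  subgroup of \<open>\<G>\<close>. Hence distances in it define an equivalence relation, which is open by
  \<open>infinitesimal_exists\<close>.
\<close>

lemma filtration_if_G_metrizable:
  fixes d :: "'a \<Rightarrow> 'a \<Rightarrow> 'g::linordered_ab_group_add"
  assumes deg: "Deg_eq TYPE('g) k" and metric: "G_metric_on (topspace X) d"
    and X: "X = G_metric_topology (topspace X) d"
    and complete: "G_Cauchy_complete k (topspace X) d"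
  shows "\<exists>N. filtration k X N \<and> complete_filtration k X N"
proof -
  let ?M = "topspace X"
  obtain r :: "'k \<Rightarrow> 'g" where r_pos: "\<And>\<alpha>. \<alpha> \<in> Field k \<Longrightarrow> 0 < r \<alpha>"
    and r_less: "\<And>\<alpha> \<beta>. \<alpha> \<in> Field k \<Longrightarrow> \<beta> \<in> underS k \<alpha> \<Longrightarrow> r \<alpha> < r \<beta>"
    and r_coinit: "\<And>\<epsilon>. 0 < \<epsilon> \<Longrightarrow> \<exists>\<alpha>\<in>Field k. r \<alpha> \<le> \<epsilon>"
    using scale_exists[OF deg] by blast
  have d0: "d x x = 0" and dsym: "d x y = d y x" and dnn: "0 \<le> d x y"
    and dpos: "x \<noteq> y \<Longrightarrow> 0 < d x y" if "x \<in> ?M" "y \<in> ?M" for x y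
    using metric that by (auto simp: G_metric_on_def order_less_le)
  have dtri: "d x z \<le> d x y + d y z" if "x \<in> ?M" "y \<in> ?M" "z \<in> ?M" for x y z
    using metric that by (auto simp: G_metric_on_def)
  have openX: "openin X U \<longleftrightarrow> U \<subseteq> ?M \<and> (\<forall>x\<in>U. \<exists>\<epsilon>>0. {y\<in>?M. d x y < \<epsilon>} \<subseteq> U)" for U
    using openin_G_metric_topology[OF metric, of U] X by simp
  define N where "N \<alpha> x = {y \<in> ?M. \<forall>n. iterated_double n (d x y) < r \<alpha>}" for \<alpha> x
  have N_sub: "y \<in> ?M" if "y \<in> N \<alpha> x" for \<alpha> x y
    using that by (simp add: N_def)
  have N_less: "d x y < r \<alpha>" if "y \<in> N \<alpha> x" for \<alpha> x y
    using that by (auto simp: N_def dest: spec[of _ 0])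
  have N_refl: "x \<in> N \<alpha> x" if "\<alpha> \<in> Field k" "x \<in> ?M" for \<alpha> x
    using that r_pos by (simp add: N_def d0)
  have N_sym: "x \<in> N \<alpha> y" if "x \<in> ?M" "y \<in> N \<alpha> x" for \<alpha> x y
    using that dsym by (simp add: N_def)
  have N_trans: "z \<in> N \<alpha> x" if "x \<in> ?M" "y \<in> N \<alpha> x" "z \<in> N \<alpha> y" for \<alpha> x y z
  proof -
    have yz: "y \<in> ?M" "z \<in> ?M"
      using that N_sub by blast+
    define m where "m = max (d x y) (d y z)"
    have m: "iterated_double n m < r \<alpha>" for n
      using that by (simp add: m_def N_def max_def)
    have "iterated_double n (d x z) < r \<alpha>" for n
    proof -
      have "d x z \<le> d x y + d y z"
        using dtri that(1) yz by blast
      also have "\<dots> \<le> m + m"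
        by (intro add_mono) (simp_all add: m_def)
      finally have "iterated_double n (d x z) \<le> iterated_double (Suc n) m"
        using iterated_double_mono by (simp add: iterated_double_Suc)
      with m[of "Suc n"] show ?thesis by simp
    qed
    then show ?thesis
      using yz by (simp add: N_def)
  qed
  have N_eq: "N \<alpha> y = N \<alpha> x" if "x \<in> ?M" "y \<in> N \<alpha> x" for \<alpha> x y
    using N_trans[OF that] N_trans[OF N_sub[OF that(2)] N_sym[OF that]] by blast
  have N_ball: "\<exists>\<epsilon>>0. {y\<in>?M. d x y < \<epsilon>} \<subseteq> N \<alpha> x" if \<alpha>: "\<alpha> \<in> Field k" for \<alpha> x
  proof -
    obtain \<delta> where \<delta>: "0 < \<delta>" "\<forall>n. iterated_double n \<delta> < r \<alpha>"
      using infinitesimal_exists[OF deg r_pos[OF \<alpha>]] by blast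
    have "{y\<in>?M. d x y < \<delta>} \<subseteq> N \<alpha> x"
    proof
      fix y assume y: "y \<in> {y\<in>?M. d x y < \<delta>}"
      have "iterated_double n (d x y) < r \<alpha>" for n
        using iterated_double_mono[of "d x y" \<delta> n] \<delta>(2)[rule_format, of n] y
        by (simp add: less_imp_le order_le_less_trans)
      then show "y \<in> N \<alpha> x"
        using y by (simp add: N_def)
    qed
    with \<delta>(1) show ?thesis by blast
  qed
  have filt: "filtration k X N"
  proof unfold_locales
    show "x \<in> N \<alpha> x" if "\<alpha> \<in> Field k" "x \<in> ?M" for \<alpha> x
      using that by (rule N_refl)
    show "openin X (N \<alpha> x)" if "\<alpha> \<in> Field k" "x \<in> ?M" for \<alpha> x
      unfolding openX using N_sub N_ball[OF that(1)] N_eq[OF that(2)] by (metis subsetI)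
    show "N \<alpha> y = N \<alpha> x" if "\<alpha> \<in> Field k" "x \<in> ?M" "y \<in> N \<alpha> x" for \<alpha> x y
      using that N_eq by blast
    show "N \<beta> x \<subseteq> N \<alpha> x" if "\<alpha> \<preceq> \<beta>" "x \<in> ?M" for \<alpha> \<beta> x
    proof -
      have "r \<beta> \<le> r \<alpha>"
        using that(1) r_less[of \<beta> \<alpha>] le_Field by (cases "\<alpha> = \<beta>") (auto simp: underS_def)
      then show ?thesis
        by (auto simp: N_def intro: order_less_le_trans)
    qed
    show "\<exists>\<alpha>\<in>Field k. N \<alpha> x \<subseteq> U" if "openin X U" "x \<in> U" for U x
    proof -
      obtain \<epsilon> where \<epsilon>: "0 < \<epsilon>" "{y\<in>?M. d x y < \<epsilon>} \<subseteq> U"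
        using \<open>openin X U\<close> \<open>x \<in> U\<close> openX by meson
      obtain \<alpha> where \<alpha>: "\<alpha> \<in> Field k" "r \<alpha> \<le> \<epsilon>"
        using r_coinit \<epsilon>(1) by blast
      have "N \<alpha> x \<subseteq> U"
      proof
        fix y assume y: "y \<in> N \<alpha> x"
        then have "d x y < \<epsilon>"
          using N_less \<alpha>(2) order_less_le_trans by blast
        then show "y \<in> U"
          using \<epsilon>(2) N_sub[OF y] by blast
      qed
      with \<alpha>(1) show ?thesis by blast
    qed
    show "x = y" if xy: "x \<in> ?M" "y \<in> ?M" "\<forall>\<alpha>\<in>Field k. y \<in> N \<alpha> x" for x y
    proof (rule ccontr)
      assume "x \<noteq> y"
      then obtain \<alpha> where "\<alpha> \<in> Field k" "r \<alpha> \<le> d x y"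
        using dpos r_coinit xy(1,2) by blast
      with xy(3) N_less show False
        using leD by blast
    qed
  qed
  moreover have "complete_filtration k X N"
    unfolding complete_filtration_def
  proof (intro allI impI, elim conjE)
    fix s assume sM: "\<forall>\<alpha>\<in>Field k. s \<alpha> \<in> ?M" and s: "\<forall>\<alpha> \<beta>. \<alpha> \<preceq> \<beta> \<longrightarrow> s \<beta> \<in> N \<alpha> (s \<alpha>)"
    have "G_Cauchy_seq k d s"
      unfolding G_Cauchy_seq_def
    proof (intro allI impI)
      fix \<epsilon> :: 'g assume "0 < \<epsilon>"
      then obtain \<alpha> where \<alpha>: "\<alpha> \<in> Field k" "r \<alpha> \<le> \<epsilon>"
        using r_coinit by blast
      have "d (s \<beta>) (s \<gamma>) < \<epsilon>" if "\<alpha> \<preceq> \<beta>" "\<alpha> \<preceq> \<gamma>" for \<beta> \<gamma>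
      proof -
        have "s \<gamma> \<in> N \<alpha> (s \<beta>)"
          using N_eq[of "s \<alpha>" "s \<beta>" \<alpha>] s sM that \<alpha>(1) by auto
        then show ?thesis
          using N_less \<alpha>(2) order_less_le_trans by blast
      qed
      with \<alpha>(1) show "\<exists>\<alpha>\<in>Field k. \<forall>\<beta> \<gamma>. \<alpha> \<preceq> \<beta> \<and> \<alpha> \<preceq> \<gamma> \<longrightarrow> d (s \<beta>) (s \<gamma>) < \<epsilon>"
        by blast
    qed
    moreover have "s ` Field k \<subseteq> ?M"
      using sM by blast
    ultimately obtain x where x: "x \<in> ?M" "G_converges k d s x"
      using complete[unfolded G_Cauchy_complete_def, rule_format, of s] by blast
    have "x \<in> N \<alpha> (s \<alpha>)" if \<alpha>: "\<alpha> \<in> Field k" for \<alpha>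
    proof -
      obtain \<epsilon> where \<epsilon>: "0 < \<epsilon>" "{y\<in>?M. d x y < \<epsilon>} \<subseteq> N \<alpha> x"
        using N_ball[OF \<alpha>] by blast
      obtain \<beta> where \<beta>: "\<beta> \<in> Field k" "\<forall>\<gamma>. \<beta> \<preceq> \<gamma> \<longrightarrow> d (s \<gamma>) x < \<epsilon>"
        using x(2) \<epsilon>(1) by (auto simp: G_converges_def)
      obtain \<gamma> where \<gamma>: "\<gamma> \<in> Field k" "\<alpha> \<preceq> \<gamma>" "\<beta> \<preceq> \<gamma>"
        using ex_upper_bound[OF \<alpha> \<beta>(1)] by blast
      have "s \<gamma> \<in> ?M" "d (s \<gamma>) x < \<epsilon>"
        using sM \<gamma> \<beta>(2) by blast+
      then have "s \<gamma> \<in> N \<alpha> x"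
        using \<epsilon>(2) dsym[OF x(1)] by auto
      moreover have "s \<gamma> \<in> N \<alpha> (s \<alpha>)"
        using s \<gamma> by blast
      ultimately show ?thesis
        using N_eq N_refl[OF \<alpha>] sM \<alpha> x(1) by metis
    qed
    with x(1) show "\<exists>x\<in>?M. \<forall>\<alpha>\<in>Field k. x \<in> N \<alpha> (s \<alpha>)"
      by blast
  qed
  ultimately show ?thesis by blast
qed

end

text \<open>
  The metric sends two distinct points to \<open>r \<delta>\<close> where \<open>\<delta>\<close> is the first level that separates them. It is
  the fact \<open>d_less\<close> that matters: balls of radius \<open>r \<alpha>\<close> are exactly the classes of level \<open>\<alpha>\<close>.
\<close>

lemma (in filtration) G_metrizable_if_complete:
  assumes deg: "Deg_eq TYPE('g::linordered_ab_group_add) k"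
    and complete: "complete_filtration k X N"
  shows "\<exists>d :: 'a \<Rightarrow> 'a \<Rightarrow> 'g. G_metric_on (topspace X) d \<and>
    X = G_metric_topology (topspace X) d \<and> G_Cauchy_complete k (topspace X) d"
proof -
  let ?M = "topspace X"
  obtain r :: "'k \<Rightarrow> 'g" where r_pos: "\<And>\<alpha>. \<alpha> \<in> Field k \<Longrightarrow> 0 < r \<alpha>"
    and r_less: "\<And>\<alpha> \<beta>. \<alpha> \<in> Field k \<Longrightarrow> \<beta> \<in> underS k \<alpha> \<Longrightarrow> r \<alpha> < r \<beta>"
    and r_coinit: "\<And>\<epsilon>. 0 < \<epsilon> \<Longrightarrow> \<exists>\<alpha>\<in>Field k. r \<alpha> \<le> \<epsilon>"
    using scale_exists[OF deg] by blast
  define lev where "lev x y = (SOME \<delta>. \<delta> \<in> Field k \<and> y \<notin> N \<delta> x \<and>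
    (\<forall>\<beta>\<in>Field k. y \<notin> N \<beta> x \<longrightarrow> \<delta> \<preceq> \<beta>))" for x y
  have lev: "lev x y \<in> Field k" "y \<notin> N (lev x y) x"
    "\<And>\<beta>. \<beta> \<in> Field k \<Longrightarrow> y \<notin> N \<beta> x \<Longrightarrow> lev x y \<preceq> \<beta>"
    if xy: "x \<in> ?M" "y \<in> ?M" "x \<noteq> y" for x y
  proof -
    obtain \<alpha> where "\<alpha> \<in> Field k" "y \<notin> N \<alpha> x"
      using separated xy by blast
    from someI_ex[OF least_exists[where P = "\<lambda>\<alpha>. y \<notin> N \<alpha> x", OF this]]
    show "lev x y \<in> Field k" "y \<notin> N (lev x y) x"
      "\<And>\<beta>. \<beta> \<in> Field k \<Longrightarrow> y \<notin> N \<beta> x \<Longrightarrow> lev x y \<preceq> \<beta>"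
      unfolding lev_def by blast+
  qed
  define d where "d x y = (if x = y then 0 else r (lev x y))" for x y
  have d_less: "d x y < r \<alpha> \<longleftrightarrow> y \<in> N \<alpha> x" if "x \<in> ?M" "y \<in> ?M" "\<alpha> \<in> Field k" for x y \<alpha>
  proof (cases "x = y")
    case True
    then show ?thesis
      using that r_pos mem_class by (simp add: d_def)
  next
    case False
    note l = lev[OF that(1,2) False]
    show ?thesis
    proof (cases "lev x y \<preceq> \<alpha>")
      case True
      then have "y \<notin> N \<alpha> x"
        using class_anti that(1) l(2) by blast
      moreover have "r \<alpha> \<le> r (lev x y)"
        using True r_less[OF that(3), of "lev x y"] by (cases "lev x y = \<alpha>") (auto simp: underS_def)
      ultimately show ?thesis
        using False by (simp add: d_def)
    next
      case less: False
      then have "r (lev x y) < r \<alpha>"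
        using r_less[OF l(1)] underS_if_not_le[OF l(1) that(3)] by blast
      moreover have "y \<in> N \<alpha> x"
        using l(3) that(3) less by blast
      ultimately show ?thesis
        using False by (simp add: d_def)
    qed
  qed
  have d_pos: "0 < d x y" if "x \<in> ?M" "y \<in> ?M" "x \<noteq> y" for x y
    using lev(1)[OF that] r_pos that by (simp add: d_def)
  have d_nonneg: "0 \<le> d x y" if "x \<in> ?M" "y \<in> ?M" for x y
    using d_pos[OF that] by (cases "x = y") (auto simp: d_def)
  have d_le: "d x y \<le> d y x" if "x \<in> ?M" "y \<in> ?M" for x y
  proof (cases "x = y")
    case False
    note l = lev[OF that False]
    have "\<not> d y x < r (lev x y)"
      using d_less[OF that(2,1) l(1)] l(2) class_sym[OF l(1) that(2)] by blast
    then show ?thesis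
      using False by (simp add: d_def)
  qed simp
  have d_tri: "d x z \<le> d x y + d y z" if "x \<in> ?M" "y \<in> ?M" "z \<in> ?M" for x y z
  proof (cases "x = z")
    case True
    then show ?thesis
      using d_nonneg that by (simp add: d_def)
  next
    case False
    note l = lev[OF that(1,3) False]
    have "y \<notin> N (lev x z) x \<or> z \<notin> N (lev x z) y"
      using class_eq[OF l(1) that(1), of y] l(2) by blast
    then have "d x z \<le> d x y \<or> d x z \<le> d y z"
      using d_less[OF that(1,2) l(1)] d_less[OF that(2,3) l(1)] False by (auto simp: d_def)
    then show ?thesis
      using add_increasing[OF d_nonneg[OF that(1,2)]] add_increasing2[OF d_nonneg[OF that(2,3)]]
      by blast
  qed
  have metric: "G_metric_on ?M d"
    unfolding G_metric_on_def
  proof (intro conjI ballI)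
    fix x y assume xy: "x \<in> ?M" "y \<in> ?M"
    show "0 \<le> d x y" using d_nonneg xy .
    show "d x y = 0 \<longleftrightarrow> x = y" using d_pos[OF xy] by (auto simp: d_def)
    show "d x y = d y x" using d_le xy by (simp add: antisym)
  qed (rule d_tri)
  moreover have "X = G_metric_topology ?M d"
    unfolding topology_eq
  proof
    fix U
    show "openin X U \<longleftrightarrow> openin (G_metric_topology ?M d) U"
      unfolding openin_G_metric_topology[OF metric]
    proof (intro iffI conjI ballI)
      assume U: "openin X U"
      then show UM: "U \<subseteq> ?M" by (rule openin_subset)
      fix x assume x: "x \<in> U"
      then obtain \<alpha> where \<alpha>: "\<alpha> \<in> Field k" "N \<alpha> x \<subseteq> U"
        using class_base U by blast
      have "{y\<in>?M. d x y < r \<alpha>} \<subseteq> U"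
        using \<alpha> d_less[OF subsetD[OF UM x] _ \<alpha>(1)] by blast
      then show "\<exists>\<epsilon>>0. {y\<in>?M. d x y < \<epsilon>} \<subseteq> U"
        using r_pos[OF \<alpha>(1)] by blast
    next
      assume U: "U \<subseteq> ?M \<and> (\<forall>x\<in>U. \<exists>\<epsilon>>0. {y\<in>?M. d x y < \<epsilon>} \<subseteq> U)"
      have "\<exists>T. openin X T \<and> x \<in> T \<and> T \<subseteq> U" if x: "x \<in> U" for x
      proof -
        obtain \<epsilon> where \<epsilon>: "0 < \<epsilon>" "{y\<in>?M. d x y < \<epsilon>} \<subseteq> U"
          using U x by blast
        obtain \<alpha> where \<alpha>: "\<alpha> \<in> Field k" "r \<alpha> \<le> \<epsilon>"
          using r_coinit[OF \<epsilon>(1)] by blast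
        have xM: "x \<in> ?M"
          using U x by blast
        have "N \<alpha> x \<subseteq> U"
        proof
          fix y assume y: "y \<in> N \<alpha> x"
          then have "y \<in> ?M"
            using class_sub[OF \<alpha>(1) xM] by blast
          moreover have "d x y < \<epsilon>"
            using d_less[OF xM \<open>y \<in> ?M\<close> \<alpha>(1)] y \<alpha>(2) by simp
          ultimately show "y \<in> U"
            using \<epsilon>(2) by blast
        qed
        then show ?thesis
          using open_class[OF \<alpha>(1) xM] mem_class[OF \<alpha>(1) xM] by blast
      qed
      then show "openin X U"
        by (subst openin_subopen) (rule ballI)
    qed
  qed
  moreover have "G_Cauchy_complete k ?M d"
    unfolding G_Cauchy_complete_def
  proof (intro allI impI, elim conjE)
    fix s assume "s ` Field k \<subseteq> ?M" and cauchy: "G_Cauchy_seq k d s"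
    then have sM: "s \<alpha> \<in> ?M" if "\<alpha> \<in> Field k" for \<alpha>
      using that by blast
    have "\<forall>\<alpha>\<in>Field k. \<exists>\<nu>. \<nu> \<in> Field k \<and> (\<forall>\<beta> \<gamma>. \<nu> \<preceq> \<beta> \<and> \<nu> \<preceq> \<gamma> \<longrightarrow> d (s \<beta>) (s \<gamma>) < r \<alpha>)"
    proof
      fix \<alpha> assume "\<alpha> \<in> Field k"
      from cauchy[unfolded G_Cauchy_seq_def Bex_def, rule_format, OF r_pos[OF this]]
      show "\<exists>\<nu>. \<nu> \<in> Field k \<and> (\<forall>\<beta> \<gamma>. \<nu> \<preceq> \<beta> \<and> \<nu> \<preceq> \<gamma> \<longrightarrow> d (s \<beta>) (s \<gamma>) < r \<alpha>)" .
    qed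
    from bchoice[OF this]
    obtain \<nu> where \<nu>: "\<forall>\<alpha>\<in>Field k. \<nu> \<alpha> \<in> Field k \<and>
        (\<forall>\<beta> \<gamma>. \<nu> \<alpha> \<preceq> \<beta> \<and> \<nu> \<alpha> \<preceq> \<gamma> \<longrightarrow> d (s \<beta>) (s \<gamma>) < r \<alpha>)"
      by (rule exE)
    have \<nu>F: "\<nu> \<alpha> \<in> Field k" if "\<alpha> \<in> Field k" for \<alpha>
      using \<nu> that by blast
    have close: "s \<beta> \<in> N \<alpha> (s (\<nu> \<alpha>))" if "\<alpha> \<in> Field k" "\<nu> \<alpha> \<preceq> \<beta>" for \<alpha> \<beta>
    proof -
      have "d (s (\<nu> \<alpha>)) (s \<beta>) < r \<alpha>"
        using \<nu> that le_refl by blast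
      then show ?thesis
        using d_less[OF sM sM] \<nu>F that le_Field by blast
    qed
    have "\<exists>x\<in>?M. \<forall>\<alpha>\<in>Field k. x \<in> N \<alpha> (s (\<nu> \<alpha>))"
    proof (rule complete[unfolded complete_filtration_def, rule_format, where s = "\<lambda>\<alpha>. s (\<nu> \<alpha>)"],
        intro conjI ballI allI impI)
      show "s (\<nu> \<alpha>) \<in> ?M" if "\<alpha> \<in> Field k" for \<alpha>
        using sM \<nu>F that by blast
      show "s (\<nu> \<beta>) \<in> N \<alpha> (s (\<nu> \<alpha>))" if ab: "\<alpha> \<preceq> \<beta>" for \<alpha> \<beta>
      proof -
        have F: "\<alpha> \<in> Field k" "\<beta> \<in> Field k"
          using ab le_Field by auto
        obtain \<gamma> where \<gamma>: "\<nu> \<alpha> \<preceq> \<gamma>" "\<nu> \<beta> \<preceq> \<gamma>"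
          using ex_upper_bound[OF \<nu>F[OF F(1)] \<nu>F[OF F(2)]] by blast
        have "s \<gamma> \<in> N \<alpha> (s (\<nu> \<beta>))"
          using close[OF F(2) \<gamma>(2)] class_anti[OF ab] sM \<nu>F F(2) by blast
        moreover have "s \<gamma> \<in> N \<alpha> (s (\<nu> \<alpha>))"
          using close[OF F(1) \<gamma>(1)] .
        ultimately show ?thesis
          using class_eq[OF F(1)] class_sym[OF F(1)] sM \<nu>F F by metis
      qed
    qed
    then obtain x where x: "x \<in> ?M" "\<And>\<alpha>. \<alpha> \<in> Field k \<Longrightarrow> x \<in> N \<alpha> (s (\<nu> \<alpha>))"
      by blast
    have "G_converges k d s x"
      unfolding G_converges_def
    proof (intro allI impI)
      fix \<epsilon> :: 'g assume "0 < \<epsilon>"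
      then obtain \<alpha> where \<alpha>: "\<alpha> \<in> Field k" "r \<alpha> \<le> \<epsilon>"
        using r_coinit by blast
      have "d (s \<beta>) x < \<epsilon>" if \<beta>: "\<nu> \<alpha> \<preceq> \<beta>" for \<beta>
      proof -
        have sb: "s \<beta> \<in> ?M"
          using \<beta> le_Field sM by blast
        have "x \<in> N \<alpha> (s \<beta>)"
          using class_eq[OF \<alpha>(1) sM[OF \<nu>F[OF \<alpha>(1)]] close[OF \<alpha>(1) \<beta>]] x(2)[OF \<alpha>(1)] by simp
        then show ?thesis
          using d_less[OF sb x(1) \<alpha>(1)] \<alpha>(2) by simp
      qed
      then show "\<exists>\<alpha>\<in>Field k. \<forall>\<beta>. \<alpha> \<preceq> \<beta> \<longrightarrow> d (s \<beta>) x < \<epsilon>"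
        using \<nu>F[OF \<alpha>(1)] by blast
    qed
    with x(1) show "\<exists>x\<in>?M. G_converges k d s x"
      by blast
  qed
  ultimately show ?thesis by blast
qed

lemma (in regular_uncountable) G_Polish_iff_complete_filtration:
  assumes deg: "Deg_eq TYPE('g::linordered_ab_group_add) k"
  shows "G_Polish TYPE('g) k X \<longleftrightarrow>
    weight_le X k \<and> (\<exists>N. filtration k X N \<and> complete_filtration k X N)"
proof
  assume "G_Polish TYPE('g) k X"
  then show "weight_le X k \<and> (\<exists>N. filtration k X N \<and> complete_filtration k X N)"
    using filtration_if_G_metrizable[OF deg] unfolding G_Polish_def by blast
next
  assume R: "weight_le X k \<and> (\<exists>N. filtration k X N \<and> complete_filtration k X N)"
  then obtain N where N: "filtration k X N" "complete_filtration k X N"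
    by blast
  show "G_Polish TYPE('g) k X"
    unfolding G_Polish_def
    using R filtration.regular_space[OF N(1)] filtration.Hausdorff_space[OF N(1)]
      filtration.G_metrizable_if_complete[OF N(1) deg N(2)] by blast
qed

section \<open>A winning strategy from a complete filtration\<close>

context regular_uncountable
begin

lemma openin_position:
  assumes "card_additive k X" "\<alpha> \<in> Field k" "\<And>\<beta>. \<beta> \<in> underS k \<alpha> \<Longrightarrow> openin X (V \<beta>)"
  shows "openin X (position k X V \<alpha>)"
proof -
  have "|V ` underS k \<alpha>| <o k"
    by (rule small_image[OF small_underS[OF assms(2)]])
  then show ?thesis
    using assms(1,3) unfolding position_def card_additive_def by blast
qed

end

text \<open>
  II answers \<open>(U, x)\<close> at stage \<open>\<alpha>\<close> with a class \<open>N \<delta> x \<subseteq> U\<close> of level \<open>\<delta> \<succeq> \<alpha>\<close>. I's points then form a branch,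
  and a point \<open>z\<close> of its intersection also lies in II's moves, although these may have levels \<open>\<delta> > \<alpha>\<close>:
  I's point at stage \<open>\<delta>\<close> is in II's move at stage \<open>\<alpha>\<close>, and \<open>z\<close> is in the class of that point at level \<open>\<delta>\<close>.
\<close>

lemma (in filtration) winning_strategy_if_complete:
  assumes complete: "complete_filtration k X N"
  shows "\<exists>\<sigma>. II_winning_strategy k X \<sigma>"
proof -
  define good where "good \<alpha> U x \<delta> \<longleftrightarrow> \<delta> \<in> Field k \<and> \<alpha> \<preceq> \<delta> \<and> N \<delta> x \<subseteq> U" for \<alpha> U x \<delta>
  define level where "level \<alpha> u = (SOME \<delta>. good \<alpha> (fst u) (snd u) \<delta>)" for \<alpha> and u :: "'a set \<times> 'a"
  define \<sigma> where "\<sigma> \<alpha> f = N (level \<alpha> (f \<alpha>)) (snd (f \<alpha>))" for \<alpha> and f :: "'k \<Rightarrow> 'a set \<times> 'a"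
  have "II_winning_strategy k X \<sigma>"
    unfolding II_winning_strategy_def Let_def
  proof (intro allI)
    fix m :: "'k \<Rightarrow> 'a set \<times> 'a"
    define V where "V = II_moves k \<sigma> m"
    have V: "V \<alpha> = N (level \<alpha> (m \<alpha>)) (snd (m \<alpha>))" if "\<alpha> \<in> Field k" for \<alpha>
      using le_refl[OF that] by (simp add: V_def II_moves_def \<sigma>_def under_def)
    (* The induction is needed because a class inside I's set exists only if that set is open in the
       whole space, which rests on the earlier answers being genuine classes. *)
    have ok: "openin X (position k X V \<alpha>) \<and> openin X (fst (m \<alpha>)) \<and> snd (m \<alpha>) \<in> topspace X \<and>
        good \<alpha> (fst (m \<alpha>)) (snd (m \<alpha>)) (level \<alpha> (m \<alpha>))"
      if "\<alpha> \<in> Field k" "\<forall>\<beta>\<in>under k \<alpha>. I_legal k X m V \<beta>" for \<alpha>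
      using that
    proof (induction \<alpha> rule: wf_induct_rule[OF wf_less])
      case (1 \<alpha>)
      have "openin X (V \<beta>)" if \<beta>: "\<beta> \<in> underS k \<alpha>" for \<beta>
      proof -
        have \<beta>F: "\<beta> \<in> Field k" and less: "(\<beta>, \<alpha>) \<in> k - Id"
          using \<beta> le_Field by (auto simp: underS_def)
        have "under k \<beta> \<subseteq> under k \<alpha>"
          using less le_trans by (auto simp: under_def)
        then have "snd (m \<beta>) \<in> topspace X" "level \<beta> (m \<beta>) \<in> Field k"
          using 1(1)[OF less \<beta>F] 1(3) by (auto simp: good_def)
        then show ?thesis
          using V[OF \<beta>F] open_class by simp
      qed
      then have pos: "openin X (position k X V \<alpha>)"
        using openin_position[OF additive 1(2)] by blast
      have "I_legal k X m V \<alpha>"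
        using 1(2,3) le_refl by (auto simp: under_def)
      then have U: "openin X (fst (m \<alpha>))" "snd (m \<alpha>) \<in> fst (m \<alpha>)"
        using openin_open_subtopology[OF pos] by (auto simp: I_legal_def)
      then have "\<exists>\<delta>. good \<alpha> (fst (m \<alpha>)) (snd (m \<alpha>)) \<delta>"
        using class_base_above[OF U 1(2)] by (auto simp: good_def)
      then have "good \<alpha> (fst (m \<alpha>)) (snd (m \<alpha>)) (level \<alpha> (m \<alpha>))"
        unfolding level_def by (rule someI_ex)
      moreover have "snd (m \<alpha>) \<in> topspace X"
        using U openin_subset by blast
      ultimately show ?case
        using pos U(1) by blast
    qed
    show "(\<forall>\<alpha>\<in>Field k. (\<forall>\<beta>\<in>under k \<alpha>. I_legal k X m (II_moves k \<sigma> m) \<beta>) \<longrightarrow>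
            II_legal k X m (II_moves k \<sigma> m) \<alpha>) \<and>
        ((\<forall>\<alpha>\<in>Field k. I_legal k X m (II_moves k \<sigma> m) \<alpha>) \<longrightarrow>
            topspace X \<inter> (\<Inter>\<alpha>\<in>Field k. II_moves k \<sigma> m \<alpha>) \<noteq> {})"
      unfolding V_def[symmetric]
    proof (intro conjI ballI impI)
      fix \<alpha> assume \<alpha>: "\<alpha> \<in> Field k" and legal: "\<forall>\<beta>\<in>under k \<alpha>. I_legal k X m V \<beta>"
      note o = ok[OF \<alpha> legal]
      have "I_legal k X m V \<alpha>"
        using \<alpha> legal le_refl by (auto simp: under_def)
      then have "fst (m \<alpha>) \<subseteq> position k X V \<alpha>"
        using openin_open_subtopology[of X "position k X V \<alpha>"] o by (auto simp: I_legal_def)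
      moreover have "V \<alpha> \<subseteq> fst (m \<alpha>)" "snd (m \<alpha>) \<in> V \<alpha>" "openin X (V \<alpha>)"
        using o open_class mem_class by (auto simp: V[OF \<alpha>] good_def)
      ultimately show "II_legal k X m V \<alpha>"
        using openin_open_subtopology[of X "position k X V \<alpha>"] o by (auto simp: II_legal_def)
    next
      assume legal: "\<forall>\<alpha>\<in>Field k. I_legal k X m V \<alpha>"
      define s where "s \<alpha> = snd (m \<alpha>)" for \<alpha>
      have o: "openin X (position k X V \<alpha>)" "s \<alpha> \<in> topspace X"
        "level \<alpha> (m \<alpha>) \<in> Field k" "\<alpha> \<preceq> level \<alpha> (m \<alpha>)" "N (level \<alpha> (m \<alpha>)) (s \<alpha>) \<subseteq> fst (m \<alpha>)"
        if "\<alpha> \<in> Field k" for \<alpha>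
        using ok[OF that] legal le_Field that by (auto simp: good_def s_def under_def)
      have sV: "s \<beta> \<in> V \<alpha>" if "\<alpha> \<preceq> \<beta>" for \<alpha> \<beta>
      proof (cases "\<alpha> = \<beta>")
        case True
        then show ?thesis
          using V[of \<beta>] o mem_class le_Field that by (auto simp: s_def)
      next
        case False
        have F: "\<beta> \<in> Field k" using that le_Field by blast
        then have "s \<beta> \<in> position k X V \<beta>"
          using legal openin_open_subtopology[OF o(1)[OF F]] by (auto simp: I_legal_def s_def)
        then show ?thesis
          using False that by (auto simp: position_def underS_def)
      qed
      have "s \<beta> \<in> N \<alpha> (s \<alpha>)" if "\<alpha> \<preceq> \<beta>" for \<alpha> \<beta>
      proof -
        have F: "\<alpha> \<in> Field k" using that le_Field by blast
        show ?thesis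
          using sV[OF that] V[OF F] class_anti[OF o(4)[OF F] o(2)[OF F]] by (auto simp: s_def)
      qed
      then obtain x where x: "x \<in> topspace X" "\<And>\<alpha>. \<alpha> \<in> Field k \<Longrightarrow> x \<in> N \<alpha> (s \<alpha>)"
        using complete[unfolded complete_filtration_def, rule_format, of s] o(2) by blast
      have "x \<in> V \<alpha>" if \<alpha>: "\<alpha> \<in> Field k" for \<alpha>
      proof -
        let ?\<delta> = "level \<alpha> (m \<alpha>)"
        have "s ?\<delta> \<in> N ?\<delta> (s \<alpha>)"
          using sV[OF o(4)[OF \<alpha>]] V[OF \<alpha>] by (simp add: s_def)
        then have "N ?\<delta> (s ?\<delta>) = N ?\<delta> (s \<alpha>)"
          using class_eq[OF o(3)[OF \<alpha>] o(2)[OF \<alpha>]] by blast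
        then show ?thesis
          using x(2)[OF o(3)[OF \<alpha>]] V[OF \<alpha>] by (simp add: s_def)
      qed
      with x(1) show "topspace X \<inter> (\<Inter>\<alpha>\<in>Field k. V \<alpha>) \<noteq> {}"
        by blast
    qed
  qed
  then show ?thesis by blast
qed

section \<open>A complete filtration from a winning strategy\<close>

context regular_uncountable
begin

text \<open>
  Regularity gives a decreasing sequence of neighbourhoods of \<open>x\<close>, alternately open and closed. Its
  intersection is closed, and by additivity open, since \<open>\<kappa>\<close> is uncountable.
\<close>

lemma clopen_between:
  assumes "regular_space X" "card_additive k X" "openin X U" "x \<in> U"
  shows "\<exists>C. openin X C \<and> closedin X C \<and> x \<in> C \<and> C \<subseteq> U"
proof -
  have nb: "\<exists>T S. openin X T \<and> closedin X S \<and> x \<in> T \<and> T \<subseteq> S \<and> S \<subseteq> W" if "openin X W" "x \<in> W" for W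
    using assms(1) that by (simp add: neighbourhood_base_of_closedin[symmetric] neighbourhood_base_of)
  define P where "P A \<longleftrightarrow> openin X (fst A) \<and> closedin X (snd A) \<and> x \<in> fst A \<and> fst A \<subseteq> snd A \<and> snd A \<subseteq> U"
    for A
  have "\<exists>A. \<forall>n::nat. P (A n) \<and> snd (A (Suc n)) \<subseteq> fst (A n)"
  proof (rule dependent_nat_choice)
    show "\<exists>A. P A"
      using nb[OF assms(3,4)] by (auto simp: P_def)
    fix A and n :: nat assume A: "P A"
    then obtain T S where "openin X T" "closedin X S" "x \<in> T" "T \<subseteq> S" "S \<subseteq> fst A"
      using nb[of "fst A"] by (auto simp: P_def)
    then show "\<exists>B. P B \<and> snd B \<subseteq> fst A"
      using A by (intro exI[of _ "(T, S)"]) (auto simp: P_def)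
  qed
  then obtain A where A: "\<And>n::nat. P (A n)" "\<And>n. snd (A (Suc n)) \<subseteq> fst (A n)"
    by blast
  let ?C = "\<Inter>n. fst (A n)"
  have "fst (A n) \<subseteq> snd (A n)" for n
    using A(1)[of n] by (simp add: P_def)
  then have "?C = (\<Inter>n. snd (A n))"
    using A(2) by blast
  moreover have "closedin X (\<Inter>n. snd (A n))"
    using A(1) by (intro closedin_Inter) (auto simp: P_def)
  moreover have "openin X (fst (A n))" for n
    using A(1)[of n] by (simp add: P_def)
  then have "openin X (topspace X \<inter> ?C)"
    using assms(2) small_range_nat[of "\<lambda>n. fst (A n)"] unfolding card_additive_def by blast
  moreover have "?C \<subseteq> fst (A 0)" "fst (A 0) \<subseteq> U" "x \<in> ?C"
    using A(1) by (auto simp: P_def)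
  moreover have "fst (A 0) \<subseteq> topspace X"
    by (rule openin_subset) fact
  ultimately show ?thesis
    by (intro exI[of _ ?C]) (auto simp: Int_absorb1)
qed

text \<open>
  There is a base of at most \<open>\<kappa>\<close> clopen sets, obtained by interpolating one between any two members of a
  given base wherever possible. Two points are in the same class of level \<open>\<alpha>\<close> if the clopen sets numbered
  up to \<open>\<alpha>\<close> do not distinguish them; a class is an intersection of fewer than \<open>\<kappa>\<close> clopen sets.
\<close>

lemma filtration_exists:
  assumes regular: "regular_space X" and Hausdorff: "Hausdorff_space X"
    and additive: "card_additive k X" and weight: "weight_le X k"
  shows "\<exists>N. filtration k X N"
proof -
  from weight obtain \<B> where "|\<B>| \<le>o k" and "\<forall>V\<in>\<B>. openin X V"
    and "\<forall>U x. openin X U \<and> x \<in> U \<longrightarrow> (\<exists>V\<in>\<B>. x \<in> V \<and> V \<subseteq> U)"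
    unfolding weight_le_def by (elim exE conjE) (rule that)
  then have \<B>: "|\<B>| \<le>o k" "\<And>U x. openin X U \<Longrightarrow> x \<in> U \<Longrightarrow> \<exists>V\<in>\<B>. x \<in> V \<and> V \<subseteq> U"
    by blast+
  define between where
    "between VW C \<longleftrightarrow> openin X C \<and> closedin X C \<and> fst VW \<subseteq> C \<and> C \<subseteq> snd VW" for VW C
  define pairs where "pairs = {VW \<in> \<B> \<times> \<B>. \<exists>C. between VW C}"
  define \<C> where "\<C> = (\<lambda>VW. SOME C. between VW C) ` pairs"
  have \<C>_between: "between VW (SOME C. between VW C)" if "VW \<in> pairs" for VW
    using that by (auto simp: pairs_def intro: someI_ex)
  have \<C>_clopen: "openin X C" "closedin X C" if "C \<in> \<C>" for C
    using that \<C>_between by (auto simp: \<C>_def between_def)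
  have \<C>_base: "\<exists>C\<in>\<C>. x \<in> C \<and> C \<subseteq> U" if U: "openin X U" "x \<in> U" for U x
  proof -
    obtain W where W: "W \<in> \<B>" "x \<in> W" "W \<subseteq> U" "openin X W"
      using \<B>(2)[OF U] \<open>\<forall>V\<in>\<B>. openin X V\<close> by blast
    obtain D where D: "openin X D" "closedin X D" "x \<in> D" "D \<subseteq> W"
      using clopen_between[OF regular additive W(4,2)] by blast
    obtain V where V: "V \<in> \<B>" "x \<in> V" "V \<subseteq> D"
      using \<B>(2)[OF D(1,3)] by blast
    have "(V, W) \<in> pairs"
      using V W D by (auto simp: pairs_def between_def)
    then have "(SOME C. between (V, W) C) \<in> \<C>" "between (V, W) (SOME C. between (V, W) C)"
      using \<C>_between by (auto simp: \<C>_def)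
    then show ?thesis
      using V(2) W(3) by (auto simp: between_def)
  qed
  have "|\<C>| \<le>o |pairs|"
    unfolding \<C>_def by (rule card_of_image)
  also have "|pairs| \<le>o |\<B> \<times> \<B>|"
    by (rule card_of_mono1) (auto simp: pairs_def)
  also have "|\<B> \<times> \<B>| \<le>o k"
    using card_of_le_times \<B>(1) by blast
  finally obtain c where c: "inj_on c \<C>" "c ` \<C> \<subseteq> Field k"
    using coding_exists by blast
  define N where "N \<alpha> x = {y \<in> topspace X. \<forall>C\<in>\<C>. c C \<preceq> \<alpha> \<longrightarrow> (x \<in> C \<longleftrightarrow> y \<in> C)}" for \<alpha> x
  have "filtration k X N"
  proof unfold_locales
    show "x \<in> N \<alpha> x" if "\<alpha> \<in> Field k" "x \<in> topspace X" for \<alpha> x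
      using that by (simp add: N_def)
    show "openin X (N \<alpha> x)" if "\<alpha> \<in> Field k" "x \<in> topspace X" for \<alpha> x
    proof -
      let ?D = "{C \<in> \<C>. c C \<preceq> \<alpha>}" and ?side = "\<lambda>C. if x \<in> C then C else topspace X - C"
      have "|?D| \<le>o |under k \<alpha>|"
        using c(1) by (intro card_of_ordLeq[THEN iffD1] exI[of _ c]) (auto simp: under_def inj_on_def)
      then have "|?side ` ?D| <o k"
        using small_under[OF that(1)] ordLeq_ordLess_trans small_image by blast
      moreover have "\<forall>U\<in>?side ` ?D. openin X U"
        using \<C>_clopen by (auto simp: closedin_def)
      ultimately have "openin X (topspace X \<inter> \<Inter>(?side ` ?D))"
        using additive unfolding card_additive_def by blast
      moreover have "N \<alpha> x = topspace X \<inter> \<Inter>(?side ` ?D)"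
        by (auto simp: N_def split: if_splits)
      ultimately show ?thesis by simp
    qed
    show "N \<alpha> y = N \<alpha> x" if "\<alpha> \<in> Field k" "x \<in> topspace X" "y \<in> N \<alpha> x" for \<alpha> x y
      using that by (auto simp: N_def)
    show "N \<beta> x \<subseteq> N \<alpha> x" if "\<alpha> \<preceq> \<beta>" "x \<in> topspace X" for \<alpha> \<beta> x
      using le_trans[OF _ that(1)] by (auto simp: N_def)
    show base: "\<exists>\<alpha>\<in>Field k. N \<alpha> x \<subseteq> U" if U: "openin X U" "x \<in> U" for U x
    proof -
      obtain C where C: "C \<in> \<C>" "x \<in> C" "C \<subseteq> U"
        using \<C>_base[OF U] by blast
      then have "c C \<in> Field k"
        using c(2) by blast
      moreover have "N (c C) x \<subseteq> U"
        using C le_refl[OF calculation] by (auto simp: N_def)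
      ultimately show ?thesis by blast
    qed
    show "x = y" if xy: "x \<in> topspace X" "y \<in> topspace X" "\<forall>\<alpha>\<in>Field k. y \<in> N \<alpha> x" for x y
    proof (rule ccontr)
      assume "x \<noteq> y"
      then obtain U V where "openin X U" "openin X V" "x \<in> U" "y \<in> V" "disjnt U V"
        using Hausdorff xy(1,2) unfolding Hausdorff_space_def by blast
      moreover then obtain \<alpha> where "\<alpha> \<in> Field k" "N \<alpha> x \<subseteq> U"
        using base by blast
      ultimately show False
        using xy(3) by (auto simp: disjnt_def)
    qed
  qed
  then show ?thesis by blast
qed

end

text \<open>
  Each point \<open>y\<close> comes with its own family of open sets \<open>W y p\<close>, where \<open>A y p\<close>, some of which contain \<open>y\<close>;
  all points of a member \<open>W y p\<close> have the same family as \<open>y\<close>. The class of \<open>y\<close> at the first level at which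
  it fits into a member of its family is the piece containing \<open>y\<close>. Since classes of different levels are
  nested or disjoint, this first level is the same for all points of the piece, so that the pieces are
  disjoint. The choice of \<open>p y\<close> depends on the piece and the family only.
\<close>

lemma (in filtration) open_covers_refined_by_partition:
  fixes A :: "'a \<Rightarrow> 'p \<Rightarrow> bool" and W :: "'a \<Rightarrow> 'p \<Rightarrow> 'a set"
  assumes cover: "\<And>y. y \<in> topspace X \<Longrightarrow> \<exists>p. A y p \<and> openin X (W y p) \<and> y \<in> W y p"
    and invariant: "\<And>y p z. y \<in> topspace X \<Longrightarrow> A y p \<Longrightarrow> z \<in> W y p \<Longrightarrow> A z = A y \<and> W z = W y"
  shows "\<exists>p C. \<forall>y\<in>topspace X. A y (p y) \<and> openin X (C y) \<and> y \<in> C y \<and> C y \<subseteq> W y (p y) \<and>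
    (\<forall>z\<in>C y. C z = C y \<and> p z = p y)"
proof -
  define Q where "Q y \<delta> \<longleftrightarrow> (\<exists>p. A y p \<and> N \<delta> y \<subseteq> W y p)" for y \<delta>
  have "\<exists>\<delta>. \<delta> \<in> Field k \<and> Q y \<delta> \<and> (\<forall>\<beta>\<in>Field k. Q y \<beta> \<longrightarrow> \<delta> \<preceq> \<beta>)" if y: "y \<in> topspace X" for y
  proof -
    obtain p where p: "A y p" "openin X (W y p)" "y \<in> W y p"
      using cover[OF y] by blast
    obtain \<delta> where "\<delta> \<in> Field k" "N \<delta> y \<subseteq> W y p"
      using class_base[OF p(2,3)] by blast
    then show ?thesis
      using least_exists[of \<delta> "Q y"] p(1) by (auto simp: Q_def)
  qed
  then have "\<forall>y\<in>topspace X. \<exists>\<delta>. \<delta> \<in> Field k \<and> Q y \<delta> \<and> (\<forall>\<beta>\<in>Field k. Q y \<beta> \<longrightarrow> \<delta> \<preceq> \<beta>)"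
    by (rule ballI)
  from bchoice[OF this] obtain \<delta> where \<delta>_all: "\<forall>y\<in>topspace X. \<delta> y \<in> Field k \<and> Q y (\<delta> y) \<and>
      (\<forall>\<beta>\<in>Field k. Q y \<beta> \<longrightarrow> \<delta> y \<preceq> \<beta>)"
    by (rule exE)
  then have \<delta>: "\<delta> y \<in> Field k" "Q y (\<delta> y)" "\<And>\<beta>. \<beta> \<in> Field k \<Longrightarrow> Q y \<beta> \<Longrightarrow> \<delta> y \<preceq> \<beta>"
    if "y \<in> topspace X" for y
    using that by auto
  define C where "C y = N (\<delta> y) y" for y
  define p where "p y = (SOME p. A y p \<and> C y \<subseteq> W y p)" for y
  have p: "A y (p y) \<and> C y \<subseteq> W y (p y)" if "y \<in> topspace X" for y
    using someI_ex[OF \<delta>(2)[OF that, unfolded Q_def]] by (simp add: p_def C_def)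
  have same: "C z = C y \<and> p z = p y" if y: "y \<in> topspace X" and z: "z \<in> C y" for y z
  proof -
    have zX: "z \<in> topspace X"
      using class_sub[OF \<delta>(1)[OF y] y] z by (auto simp: C_def)
    have inv: "A z = A y" "W z = W y"
      using invariant[OF y, of "p y" z] p[OF y] z by auto
    have eq: "N (\<delta> y) z = N (\<delta> y) y"
      using class_eq[OF \<delta>(1)[OF y] y] z by (simp add: C_def)
    then have "Q z (\<delta> y)"
      using \<delta>(2)[OF y] inv by (simp add: Q_def)
    then have le: "\<delta> z \<preceq> \<delta> y"
      using \<delta>(3)[OF zX \<delta>(1)[OF y]] by blast
    have "y \<in> N (\<delta> z) z"
      using class_anti[OF le zX] eq mem_class[OF \<delta>(1)[OF y] y] by blast
    then have "Q y (\<delta> z)"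
      using class_eq[OF \<delta>(1)[OF zX] zX] \<delta>(2)[OF zX] inv by (simp add: Q_def)
    then have "\<delta> y = \<delta> z"
      using \<delta>(3)[OF y \<delta>(1)[OF zX]] le le_antisym by blast
    then have "C z = C y"
      using eq by (simp add: C_def)
    then show ?thesis
      using inv by (simp add: p_def)
  qed
  have op: "openin X (C y)" "y \<in> C y" if "y \<in> topspace X" for y
    using \<delta>(1)[OF that] open_class mem_class that by (simp_all add: C_def)
  show ?thesis
  proof (intro exI ballI conjI)
    fix y assume y: "y \<in> topspace X"
    show "A y (p y)" "C y \<subseteq> W y (p y)" using p[OF y] by simp_all
    show "openin X (C y)" "y \<in> C y" using op[OF y] .
    show "C z = C y" "p z = p y" if "z \<in> C y" for z
      using same[OF y that] by simp_all
  qed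
qed


text \<open>
  The recursion produces for each level \<open>\<alpha>\<close> and point \<open>y\<close> a pair \<open>D \<alpha>\<close> of functions: \<open>fst (D \<alpha>) y\<close> is I's move
  and \<open>snd (D \<alpha>) y\<close> the class at stage \<open>\<alpha>\<close> on the branch of \<open>y\<close>. I plays the intersection \<open>K D \<alpha> y\<close> of the
  earlier classes, cut down to a class of \<open>N\<close> so that the new partition refines the old one. Points in
  the same class share all their moves up to that stage, hence a branch of classes determines a run.
\<close>

lemma (in filtration) complete_filtration_if_winning_strategy:
  assumes winning: "II_winning_strategy k X \<sigma>"
  shows "\<exists>F. filtration k X F \<and> complete_filtration k X F"
proof -
  have legal_answer: "II_legal k X m (II_moves k \<sigma> m) \<alpha>"
    if "\<alpha> \<in> Field k" "\<forall>\<beta>\<in>under k \<alpha>. I_legal k X m (II_moves k \<sigma> m) \<beta>" for m \<alpha>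
    using winning that unfolding II_winning_strategy_def Let_def by blast
  have wins: "topspace X \<inter> (\<Inter>\<alpha>\<in>Field k. II_moves k \<sigma> m \<alpha>) \<noteq> {}"
    if "\<forall>\<alpha>\<in>Field k. I_legal k X m (II_moves k \<sigma> m) \<alpha>" for m
    using winning that unfolding II_winning_strategy_def Let_def by blast

  (* I's possible moves \<open>q\<close> at stage \<open>\<alpha>\<close> on the branch of \<open>y\<close> are those with \<open>A D \<alpha> y q\<close>, and
     \<open>W D \<alpha> y q\<close> is II's answer to the run that follows the branch of \<open>y\<close> and ends with \<open>q\<close>. *)
  define K where "K D \<alpha> y = position k X (\<lambda>\<beta>. snd (D \<beta>) y) \<alpha>"
    for D :: "'k \<Rightarrow> ('a \<Rightarrow> 'a set \<times> 'a) \<times> ('a \<Rightarrow> 'a set)" and \<alpha> y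
  define run where "run D \<alpha> y q = (\<lambda>\<beta>. if \<beta> \<in> underS k \<alpha> then fst (D \<beta>) y else q)"
    for D :: "'k \<Rightarrow> ('a \<Rightarrow> 'a set \<times> 'a) \<times> ('a \<Rightarrow> 'a set)" and \<alpha> y q
  define A where "A D \<alpha> y q \<longleftrightarrow> snd q \<in> K D \<alpha> y \<and> fst q = K D \<alpha> y \<inter> N \<alpha> (snd q)" for D \<alpha> y q
  define W where "W D \<alpha> y q = II_moves k \<sigma> (run D \<alpha> y q) \<alpha>" for D \<alpha> y q
  define P where "P D \<alpha> r \<longleftrightarrow> (\<alpha> \<in> Field k \<longrightarrow> (\<forall>y\<in>topspace X. A D \<alpha> y (fst r y) \<and>
      openin X (snd r y) \<and> y \<in> snd r y \<and> snd r y \<subseteq> W D \<alpha> y (fst r y) \<and> snd r y \<subseteq> fst (fst r y) \<and>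
      (\<forall>z\<in>snd r y. snd r z = snd r y \<and> fst r z = fst r y)))" for D \<alpha> r

  have I_legalI: "I_legal k X m V \<alpha>"
    if "openin X L" "L \<subseteq> position k X V \<alpha>" "snd (m \<alpha>) \<in> L" "fst (m \<alpha>) = L \<inter> N \<alpha> (snd (m \<alpha>))"
      "\<alpha> \<in> Field k" for m V \<alpha> L
  proof -
    have x: "snd (m \<alpha>) \<in> topspace X"
      using that(1,3) openin_subset by blast
    have "openin X (fst (m \<alpha>))"
      using that(1,4) open_class[OF that(5) x] by auto
    moreover have "fst (m \<alpha>) = fst (m \<alpha>) \<inter> position k X V \<alpha>"
      using that(2,4) by blast
    ultimately have "openin (subtopology X (position k X V \<alpha>)) (fst (m \<alpha>))"
      unfolding openin_subtopology by blast
    then show ?thesis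
      using that(3,4) mem_class[OF that(5) x] by (simp add: I_legal_def)
  qed

  have "\<exists>D. \<forall>\<alpha>. P D \<alpha> (D \<alpha>)"
  proof (rule dependent_wf_choice[OF wf_less, where P = P])
    fix f g :: "'k \<Rightarrow> ('a \<Rightarrow> 'a set \<times> 'a) \<times> ('a \<Rightarrow> 'a set)" and \<alpha> r
    assume eq: "\<And>\<beta>. (\<beta>, \<alpha>) \<in> k - Id \<Longrightarrow> f \<beta> = g \<beta>"
    have fg: "f \<beta> = g \<beta>" if "\<beta> \<in> underS k \<alpha>" for \<beta>
      using eq[of \<beta>] that by (auto simp: underS_def)
    have "K f \<alpha> = K g \<alpha>" "run f \<alpha> = run g \<alpha>"
      using fg by (auto simp: K_def run_def position_def fun_eq_iff)
    then have "A f \<alpha> = A g \<alpha>" "W f \<alpha> = W g \<alpha>"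
      by (intro ext, simp add: A_def W_def)+
    then show "P f \<alpha> r = P g \<alpha> r"
      by (simp add: P_def)
  next
    fix \<alpha> and D :: "'k \<Rightarrow> ('a \<Rightarrow> 'a set \<times> 'a) \<times> ('a \<Rightarrow> 'a set)"
    assume IH: "\<And>\<beta>. (\<beta>, \<alpha>) \<in> k - Id \<Longrightarrow> P D \<beta> (D \<beta>)"
    show "\<exists>r. P D \<alpha> r"
    proof (cases "\<alpha> \<in> Field k")
      case True
      note \<alpha> = True
      have below: "A D \<beta> y (fst (D \<beta>) y)" "openin X (snd (D \<beta>) y)" "y \<in> snd (D \<beta>) y"
        "snd (D \<beta>) y \<subseteq> W D \<beta> y (fst (D \<beta>) y)"
        "\<And>z. z \<in> snd (D \<beta>) y \<Longrightarrow> snd (D \<beta>) z = snd (D \<beta>) y \<and> fst (D \<beta>) z = fst (D \<beta>) y"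
        if "\<beta> \<in> underS k \<alpha>" "y \<in> topspace X" for \<beta> y
      proof -
        have "P D \<beta> (D \<beta>)" "\<beta> \<in> Field k"
          using IH that(1) le_Field by (auto simp: underS_def)
        note p = this(1)[unfolded P_def, rule_format, OF this(2) that(2)]
        from p show "A D \<beta> y (fst (D \<beta>) y)" by blast
        from p show "openin X (snd (D \<beta>) y)" by blast
        from p show "y \<in> snd (D \<beta>) y" by blast
        from p show "snd (D \<beta>) y \<subseteq> W D \<beta> y (fst (D \<beta>) y)" by blast
        from p show "snd (D \<beta>) z = snd (D \<beta>) y \<and> fst (D \<beta>) z = fst (D \<beta>) y"
          if "z \<in> snd (D \<beta>) y" for z using that by blast
      qed
      have underS_sub: "underS k \<beta> \<subseteq> underS k \<alpha>" if "\<beta> \<in> under k \<alpha>" for \<beta>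
        using that le_trans le_antisym by (auto simp: under_def underS_def)
      have K_open: "openin X (K D \<beta> y)" if "\<beta> \<in> under k \<alpha>" "y \<in> topspace X" for \<beta> y
        unfolding K_def
      proof (rule openin_position[OF additive])
        show "\<beta> \<in> Field k"
          using that(1) le_Field by (auto simp: under_def)
        show "openin X (snd (D \<gamma>) y)" if "\<gamma> \<in> underS k \<beta>" for \<gamma>
          using that underS_sub[OF \<open>\<beta> \<in> under k \<alpha>\<close>] below(2) \<open>y \<in> topspace X\<close> by blast
      qed
      have K_mem: "y \<in> K D \<alpha> y" if "y \<in> topspace X" for y
        using that below(3) by (simp add: K_def position_def)
      have K_coherent: "A D \<alpha> z = A D \<alpha> y \<and> W D \<alpha> z = W D \<alpha> y"
        if y: "y \<in> topspace X" and z: "z \<in> K D \<alpha> y" for y z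
      proof -
        have eq: "snd (D \<beta>) z = snd (D \<beta>) y" "fst (D \<beta>) z = fst (D \<beta>) y" if "\<beta> \<in> underS k \<alpha>" for \<beta>
          using below(5)[OF that y, of z] z that by (auto simp: K_def position_def)
        have "K D \<alpha> z = K D \<alpha> y" "run D \<alpha> z = run D \<alpha> y"
          using eq by (simp_all add: K_def position_def run_def fun_eq_iff)
        then have "A D \<alpha> z = A D \<alpha> y" "W D \<alpha> z = W D \<alpha> y"
          by (intro ext, simp add: A_def W_def)+
        then show ?thesis ..
      qed
      (* The run that reaches \<open>y\<close> is legal up to stage \<open>\<alpha>\<close>, so the strategy has to answer legally. *)
      have answer: "openin X (W D \<alpha> y q) \<and> snd q \<in> W D \<alpha> y q \<and> W D \<alpha> y q \<subseteq> fst q"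
        if y: "y \<in> topspace X" and q: "A D \<alpha> y q" for y q
      proof -
        define m where "m = run D \<alpha> y q"
        define V where "V = II_moves k \<sigma> m"
        have m\<alpha>: "m \<alpha> = q"
          by (simp add: m_def run_def underS_def)
        have m: "m \<beta> = fst (D \<beta>) y" if "\<beta> \<in> underS k \<alpha>" for \<beta>
          using that by (simp add: m_def run_def)
        have V: "V \<beta> = W D \<beta> y (fst (D \<beta>) y)" if \<beta>: "\<beta> \<in> underS k \<alpha>" for \<beta>
        proof -
          have "m \<gamma> = run D \<beta> y (fst (D \<beta>) y) \<gamma>" if "\<gamma> \<in> under k \<beta>" for \<gamma>
          proof (cases "\<gamma> = \<beta>")
            case True
            then show ?thesis
              using m[OF \<beta>] by (simp add: run_def)
          next
            case False
            then have "\<gamma> \<in> underS k \<beta>"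
              using that by (simp add: under_def underS_def)
            moreover then have "\<gamma> \<in> underS k \<alpha>"
              using underS_sub[of \<beta>] \<beta> by (auto simp: under_def underS_def)
            ultimately show ?thesis
              using m by (simp add: run_def)
          qed
          then have "restrict m (under k \<beta>) = restrict (run D \<beta> y (fst (D \<beta>) y)) (under k \<beta>)"
            by (rule restrict_ext)
          then show ?thesis
            by (simp add: V_def W_def II_moves_def)
        qed
        have "I_legal k X m V \<beta>" if \<beta>: "\<beta> \<in> under k \<alpha>" for \<beta>
        proof (rule I_legalI)
          show "openin X (K D \<beta> y)"
            using K_open[OF \<beta> y] .
          show "K D \<beta> y \<subseteq> position k X V \<beta>"
            using underS_sub[OF \<beta>] V below(4)[OF _ y] unfolding K_def position_def by blast
          have "A D \<beta> y (m \<beta>)"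
          proof (cases "\<beta> = \<alpha>")
            case True
            then show ?thesis using q m\<alpha> by simp
          next
            case False
            then have "\<beta> \<in> underS k \<alpha>"
              using \<beta> by (simp add: under_def underS_def)
            then show ?thesis using below(1) m y by simp
          qed
          then show "snd (m \<beta>) \<in> K D \<beta> y" "fst (m \<beta>) = K D \<beta> y \<inter> N \<beta> (snd (m \<beta>))"
            by (simp_all add: A_def)
          show "\<beta> \<in> Field k"
            using \<beta> le_Field by (auto simp: under_def)
        qed
        then have II: "II_legal k X m V \<alpha>"
          using legal_answer[OF \<alpha>, of m] by (simp add: V_def)
        then obtain T where T: "openin X T" "V \<alpha> = T \<inter> position k X V \<alpha>"
          unfolding II_legal_def openin_subtopology by blast
        have sub: "V \<alpha> \<subseteq> fst q" "snd q \<in> V \<alpha>"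
          using II by (auto simp: II_legal_def m\<alpha>)
        have "fst q \<subseteq> K D \<alpha> y" "fst q = K D \<alpha> y \<inter> N \<alpha> (snd q)" "snd q \<in> K D \<alpha> y"
          using q by (auto simp: A_def)
        moreover have "K D \<alpha> y \<subseteq> position k X V \<alpha>"
          using V below(4)[OF _ y] unfolding K_def position_def by blast
        ultimately have eq: "V \<alpha> = T \<inter> fst q"
          using T(2) sub(1) by blast
        have \<alpha>u: "\<alpha> \<in> under k \<alpha>"
          using le_refl[OF \<alpha>] by (simp add: under_def)
        have "snd q \<in> topspace X"
          using q by (simp add: A_def K_def position_def)
        then have "openin X (fst q)"
          using q K_open[OF \<alpha>u y] open_class[OF \<alpha>] by (auto simp: A_def)
        then have "openin X (V \<alpha>)"
          using eq T(1) by auto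
        moreover have "W D \<alpha> y q = V \<alpha>"
          by (simp add: W_def V_def m_def)
        ultimately show ?thesis
          using sub by simp
      qed
      have "\<exists>p C. \<forall>y\<in>topspace X. A D \<alpha> y (p y) \<and> openin X (C y) \<and> y \<in> C y \<and>
          C y \<subseteq> W D \<alpha> y (p y) \<and> (\<forall>z\<in>C y. C z = C y \<and> p z = p y)"
      proof (rule open_covers_refined_by_partition)
        fix y assume y: "y \<in> topspace X"
        have "A D \<alpha> y (K D \<alpha> y \<inter> N \<alpha> y, y)"
          using K_mem[OF y] by (simp add: A_def)
        then show "\<exists>q. A D \<alpha> y q \<and> openin X (W D \<alpha> y q) \<and> y \<in> W D \<alpha> y q"
          using answer[OF y] by fastforce
      next
        fix y q z assume y: "y \<in> topspace X" and q: "A D \<alpha> y q" and z: "z \<in> W D \<alpha> y q"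
        have "z \<in> K D \<alpha> y"
          using answer[OF y q] z q by (auto simp: A_def)
        then show "A D \<alpha> z = A D \<alpha> y \<and> W D \<alpha> z = W D \<alpha> y"
          by (rule K_coherent[OF y])
      qed
      then obtain p C where pC: "\<forall>y\<in>topspace X. A D \<alpha> y (p y) \<and> openin X (C y) \<and> y \<in> C y \<and>
          C y \<subseteq> W D \<alpha> y (p y) \<and> (\<forall>z\<in>C y. C z = C y \<and> p z = p y)"
        by (elim exE) (rule that)
      have "P D \<alpha> (p, C)"
        unfolding P_def fst_conv snd_conv
      proof (intro impI ballI)
        fix y assume y: "y \<in> topspace X"
        note pCy = bspec[OF pC y]
        then have "C y \<subseteq> fst (p y)"
          using answer[OF y, of "p y"] by blast
        with pCy show "A D \<alpha> y (p y) \<and> openin X (C y) \<and> y \<in> C y \<and> C y \<subseteq> W D \<alpha> y (p y) \<and>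
            C y \<subseteq> fst (p y) \<and> (\<forall>z\<in>C y. C z = C y \<and> p z = p y)"
          by blast
      qed
      then show ?thesis by blast
    qed (simp add: P_def)
  qed
  then obtain D where "\<And>\<alpha>. P D \<alpha> (D \<alpha>)"
    by blast
  note D_all = this[unfolded P_def, rule_format]
  define p C where "p \<alpha> y = fst (D \<alpha>) y" and "C \<alpha> y = snd (D \<alpha>) y" for \<alpha> y
  have D: "A D \<alpha> y (p \<alpha> y)" "openin X (C \<alpha> y)" "y \<in> C \<alpha> y" "C \<alpha> y \<subseteq> W D \<alpha> y (p \<alpha> y)"
    "C \<alpha> y \<subseteq> fst (p \<alpha> y)" if "\<alpha> \<in> Field k" "y \<in> topspace X" for \<alpha> y
    using D_all[OF that] unfolding p_def C_def by blast+
  have same: "C \<alpha> z = C \<alpha> y" "p \<alpha> z = p \<alpha> y" if "\<alpha> \<in> Field k" "y \<in> topspace X" "z \<in> C \<alpha> y" for \<alpha> y z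
    using D_all[OF that(1,2)] that(3) unfolding p_def C_def by blast+
  have sub_K: "C \<beta> y \<subseteq> K D \<beta> y" if "\<beta> \<in> Field k" "y \<in> topspace X" for \<beta> y
    using D(1,5)[OF that] by (auto simp: A_def)
  have K_sub: "K D \<beta> y \<subseteq> C \<alpha> y" if "\<alpha> \<in> underS k \<beta>" for \<alpha> \<beta> y
    using that by (auto simp: K_def position_def C_def)
  have C_anti: "C \<beta> y \<subseteq> C \<alpha> y" if "\<alpha> \<preceq> \<beta>" "y \<in> topspace X" for \<alpha> \<beta> y
  proof (cases "\<alpha> = \<beta>")
    case False
    then have "\<alpha> \<in> underS k \<beta>"
      using that(1) by (simp add: underS_def)
    then show ?thesis
      using K_sub sub_K le_Field that by blast
  qed simp
  have C_sub: "C \<alpha> y \<subseteq> N \<alpha> y" if "\<alpha> \<in> Field k" "y \<in> topspace X" for \<alpha> y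
  proof -
    define x where "x = snd (p \<alpha> y)"
    have x: "x \<in> topspace X" and sub: "C \<alpha> y \<subseteq> N \<alpha> x"
      using D(1,5)[OF that] by (auto simp: A_def K_def position_def x_def)
    have "y \<in> N \<alpha> x"
      using sub D(3)[OF that] by blast
    then show ?thesis
      using sub class_eq[OF that(1) x] by blast
  qed

  have "filtration k X C"
  proof unfold_locales
    show "\<exists>\<alpha>\<in>Field k. C \<alpha> x \<subseteq> U" if U: "openin X U" "x \<in> U" for U x
    proof -
      obtain \<alpha> where "\<alpha> \<in> Field k" "N \<alpha> x \<subseteq> U"
        using class_base[OF U] by blast
      moreover have "x \<in> topspace X"
        using openin_subset[OF U(1)] U(2) by blast
      ultimately show ?thesis
        using C_sub by blast
    qed
    show "x = y" if xy: "x \<in> topspace X" "y \<in> topspace X" "\<forall>\<alpha>\<in>Field k. y \<in> C \<alpha> x" for x y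
      using separated[OF xy(1,2)] C_sub xy by blast
    show "x \<in> C \<alpha> x" "openin X (C \<alpha> x)" if "\<alpha> \<in> Field k" "x \<in> topspace X" for \<alpha> x
      using D(3)[OF that] D(2)[OF that] .
    show "C \<alpha> y = C \<alpha> x" if "\<alpha> \<in> Field k" "x \<in> topspace X" "y \<in> C \<alpha> x" for \<alpha> x y
      using same(1)[OF that] .
    show "C \<beta> x \<subseteq> C \<alpha> x" if "\<alpha> \<preceq> \<beta>" "x \<in> topspace X" for \<alpha> \<beta> x
      using C_anti[OF that] .
  qed
  moreover have "complete_filtration k X C"
    unfolding complete_filtration_def
  proof (intro allI impI, elim conjE)
    fix s assume "\<forall>\<alpha>\<in>Field k. s \<alpha> \<in> topspace X" and s: "\<forall>\<alpha> \<beta>. \<alpha> \<preceq> \<beta> \<longrightarrow> s \<beta> \<in> C \<alpha> (s \<alpha>)"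
    then have sX: "s \<alpha> \<in> topspace X" if "\<alpha> \<in> Field k" for \<alpha>
      using that by blast
    have s_same: "C \<alpha> (s \<beta>) = C \<alpha> (s \<alpha>)" "p \<alpha> (s \<beta>) = p \<alpha> (s \<alpha>)" if "\<alpha> \<preceq> \<beta>" for \<alpha> \<beta>
    proof -
      have F: "\<alpha> \<in> Field k"
        using that le_Field by blast
      have "s \<beta> \<in> C \<alpha> (s \<alpha>)"
        using s that by blast
      then show "C \<alpha> (s \<beta>) = C \<alpha> (s \<alpha>)" "p \<alpha> (s \<beta>) = p \<alpha> (s \<alpha>)"
        using same[OF F sX[OF F]] by blast+
    qed
    define m where "m \<alpha> = p \<alpha> (s \<alpha>)" for \<alpha>
    define V where "V = II_moves k \<sigma> m"
    have V: "V \<alpha> = W D \<alpha> (s \<alpha>) (p \<alpha> (s \<alpha>))" for \<alpha>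
    proof -
      have "m \<gamma> = run D \<alpha> (s \<alpha>) (p \<alpha> (s \<alpha>)) \<gamma>" if "\<gamma> \<in> under k \<alpha>" for \<gamma>
        using that s_same(2)[of \<gamma> \<alpha>] by (auto simp: m_def run_def under_def underS_def p_def)
      then have "restrict m (under k \<alpha>) = restrict (run D \<alpha> (s \<alpha>) (p \<alpha> (s \<alpha>))) (under k \<alpha>)"
        by (rule restrict_ext)
      then show ?thesis
        by (simp add: V_def W_def II_moves_def)
    qed
    have C_V: "C \<alpha> (s \<alpha>) \<subseteq> V \<alpha>" if "\<alpha> \<in> Field k" for \<alpha>
      using D(4)[OF that sX[OF that]] V by simp
    have "I_legal k X m V \<alpha>" if \<alpha>: "\<alpha> \<in> Field k" for \<alpha>
    proof (rule I_legalI)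
      show "openin X (K D \<alpha> (s \<alpha>))"
        unfolding K_def
      proof (rule openin_position[OF additive \<alpha>])
        fix \<beta> assume "\<beta> \<in> underS k \<alpha>"
        then have "\<beta> \<in> Field k"
          using le_Field by (auto simp: underS_def)
        then show "openin X (snd (D \<beta>) (s \<alpha>))"
          using D(2) sX[OF \<alpha>] by (simp add: C_def)
      qed
      show "K D \<alpha> (s \<alpha>) \<subseteq> position k X V \<alpha>"
      proof -
        have "C \<beta> (s \<alpha>) \<subseteq> V \<beta>" if "\<beta> \<in> underS k \<alpha>" for \<beta>
          using that s_same(1)[of \<beta> \<alpha>] C_V[of \<beta>] le_Field by (auto simp: underS_def)
        then show ?thesis
          unfolding K_def position_def C_def by blast
      qed
      show "snd (m \<alpha>) \<in> K D \<alpha> (s \<alpha>)" "fst (m \<alpha>) = K D \<alpha> (s \<alpha>) \<inter> N \<alpha> (snd (m \<alpha>))"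
        using D(1)[OF \<alpha> sX[OF \<alpha>]] by (simp_all add: m_def A_def)
    qed (rule \<alpha>)
    then have "topspace X \<inter> (\<Inter>\<alpha>\<in>Field k. V \<alpha>) \<noteq> {}"
      unfolding V_def by (intro wins) blast
    then obtain x where x: "x \<in> topspace X" "\<And>\<alpha>. \<alpha> \<in> Field k \<Longrightarrow> x \<in> V \<alpha>"
      by blast
    have "x \<in> C \<alpha> (s \<alpha>)" if \<alpha>: "\<alpha> \<in> Field k" for \<alpha>
    proof -
      (* II's move at stage \<open>\<alpha>\<close> only contains the class; but the move at any later stage is
         contained in it. *)
      obtain \<beta> where \<beta>: "\<beta> \<in> Field k" "\<alpha> \<in> underS k \<beta>"
        using ex_greater[OF \<alpha>] by blast
      have "II_legal k X m V \<beta>"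
        using legal_answer[OF \<beta>(1), of m] \<open>\<And>\<alpha>. \<alpha> \<in> Field k \<Longrightarrow> I_legal k X m V \<alpha>\<close> le_Field
        by (auto simp: V_def under_def)
      then have "V \<beta> \<subseteq> fst (m \<beta>)"
        by (simp add: II_legal_def)
      also have "\<dots> \<subseteq> K D \<beta> (s \<beta>)"
        using D(1)[OF \<beta>(1) sX[OF \<beta>(1)]] by (auto simp: m_def A_def)
      also have "\<dots> \<subseteq> C \<alpha> (s \<beta>)"
        by (rule K_sub[OF \<beta>(2)])
      also have "\<dots> = C \<alpha> (s \<alpha>)"
        using s_same(1) \<beta>(2) by (simp add: underS_def)
      finally show ?thesis
        using x(2)[OF \<beta>(1)] by blast
    qed
    with x(1) show "\<exists>x\<in>topspace X. \<forall>\<alpha>\<in>Field k. x \<in> C \<alpha> (s \<alpha>)"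
      by blast
  qed
  ultimately show ?thesis by blast
qed

lemma (in regular_uncountable) additive_fSC_iff_complete_filtration:
  "card_additive k X \<and> fSC_space k X \<longleftrightarrow>
    weight_le X k \<and> (\<exists>N. filtration k X N \<and> complete_filtration k X N)"
proof
  assume L: "card_additive k X \<and> fSC_space k X"
  then obtain N \<sigma> where N: "filtration k X N" and \<sigma>: "II_winning_strategy k X \<sigma>"
    using filtration_exists unfolding fSC_space_def by blast
  show "weight_le X k \<and> (\<exists>N. filtration k X N \<and> complete_filtration k X N)"
    using L filtration.complete_filtration_if_winning_strategy[OF N \<sigma>] by (simp add: fSC_space_def)
next
  assume R: "weight_le X k \<and> (\<exists>N. filtration k X N \<and> complete_filtration k X N)"
  then obtain N where N: "filtration k X N" "complete_filtration k X N"
    by blast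
  show "card_additive k X \<and> fSC_space k X"
    unfolding fSC_space_def
    using R filtration.additive[OF N(1)] filtration.regular_space[OF N(1)]
      filtration.Hausdorff_space[OF N(1)] filtration.winning_strategy_if_complete[OF N] by blast
qed

section \<open>Subspaces, sums and products\<close>

lemma weight_le_subtopology:
  assumes "weight_le X k"
  shows "weight_le (subtopology X S) k"
proof -
  from assms obtain \<B> where \<B>: "|\<B>| \<le>o k" "\<forall>V\<in>\<B>. openin X V"
    "\<forall>U x. openin X U \<and> x \<in> U \<longrightarrow> (\<exists>V\<in>\<B>. x \<in> V \<and> V \<subseteq> U)"
    unfolding weight_le_def by (elim exE conjE) (rule that)
  have "|(\<lambda>V. V \<inter> S) ` \<B>| \<le>o k"
    using card_of_image \<B>(1) ordLeq_transitive by blast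
  moreover have "\<forall>V\<in>(\<lambda>V. V \<inter> S) ` \<B>. openin (subtopology X S) V"
    using \<B>(2) by (auto simp: openin_subtopology)
  moreover have "\<exists>V\<in>(\<lambda>V. V \<inter> S) ` \<B>. x \<in> V \<and> V \<subseteq> U"
    if U: "openin (subtopology X S) U" "x \<in> U" for U x
  proof -
    obtain T where T: "openin X T" "U = T \<inter> S"
      using U(1) unfolding openin_subtopology by blast
    then obtain V where "V \<in> \<B>" "x \<in> V" "V \<subseteq> T"
      using \<B>(3)[rule_format, of T x] U(2) by blast
    then show ?thesis
      using T U(2) by (intro bexI[of _ "V \<inter> S"]) auto
  qed
  ultimately show ?thesis
    unfolding weight_le_def by (intro exI[of _ "(\<lambda>V. V \<inter> S) ` \<B>"]) simp
qed

text \<open>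
  Let \<open>S\<close> be the intersection of the open sets \<open>W \<beta>\<close>. Two points of \<open>S\<close> are to be equivalent at level \<open>\<alpha>\<close>
  if they are so for \<open>N\<close> and moreover, for each \<open>\<beta> \<preceq> \<alpha>\<close>, share a class of \<open>N\<close>, of whatever level, that is
  contained in \<open>W \<beta>\<close>. The common point of a branch in the whole space is then in each \<open>W \<beta>\<close>, because
  classes are closed.
\<close>

lemma (in filtration) filtration_gdelta:
  assumes complete: "complete_filtration k X N" and S: "card_gdelta_in k X S"
  shows "\<exists>F. filtration k (subtopology X S) F \<and> complete_filtration k (subtopology X S) F"
proof -
  obtain W where W: "\<And>\<alpha>. \<alpha> \<in> Field k \<Longrightarrow> openin X (W \<alpha>)" "S = topspace X \<inter> (\<Inter>\<alpha>\<in>Field k. W \<alpha>)"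
    using S unfolding card_gdelta_in_def by blast
  have topS: "topspace (subtopology X S) = S"
    using W(2) by auto
  have SX: "x \<in> topspace X" if "x \<in> S" for x
    using that W(2) by blast
  define close where
    "close \<beta> x y \<longleftrightarrow> (\<exists>\<delta>\<in>Field k. y \<in> N \<delta> x \<and> N \<delta> x \<subseteq> W \<beta>)" for \<beta> x y
  have close_refl: "close \<beta> x x" if bx: "\<beta> \<in> Field k" "x \<in> S" for \<beta> x
  proof -
    have "x \<in> W \<beta>"
      using bx W(2) by blast
    then obtain \<delta> where "\<delta> \<in> Field k" "N \<delta> x \<subseteq> W \<beta>"
      using class_base[OF W(1)[OF bx(1)]] by blast
    then show ?thesis
      using mem_class SX[OF bx(2)] by (auto simp: close_def)
  qed
  have close_sym: "close \<beta> y x" if "close \<beta> x y" "x \<in> S" for \<beta> x y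
    using that class_eq class_sym SX unfolding close_def by metis
  have close_trans: "close \<beta> x z" if xy: "close \<beta> x y" and yz: "close \<beta> y z" and x: "x \<in> S" for \<beta> x y z
  proof -
    obtain \<delta> where \<delta>: "\<delta> \<in> Field k" "y \<in> N \<delta> x" "N \<delta> x \<subseteq> W \<beta>"
      using xy by (auto simp: close_def)
    obtain \<epsilon> where \<epsilon>: "\<epsilon> \<in> Field k" "z \<in> N \<epsilon> y" "N \<epsilon> y \<subseteq> W \<beta>"
      using yz by (auto simp: close_def)
    have y: "y \<in> topspace X"
      using class_sub[OF \<delta>(1) SX[OF x]] \<delta>(2) by blast
    note eq = class_eq[OF \<delta>(1) SX[OF x] \<delta>(2)]
    show ?thesis
    proof (cases "\<delta> \<preceq> \<epsilon>")
      case True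
      then have "z \<in> N \<delta> x"
        using class_anti[OF True y] \<epsilon>(2) eq by blast
      with \<delta> show ?thesis
        by (auto simp: close_def)
    next
      case False
      then have "\<epsilon> \<preceq> \<delta>"
        using le_total \<delta>(1) \<epsilon>(1) by blast
      then have "x \<in> N \<epsilon> y"
        using class_anti[OF _ y] eq mem_class[OF \<delta>(1) SX[OF x]] by blast
      then have "N \<epsilon> x = N \<epsilon> y"
        by (rule class_eq[OF \<epsilon>(1) y])
      with \<epsilon> show ?thesis
        by (auto simp: close_def)
    qed
  qed
  define F where "F \<alpha> x = {y \<in> S. y \<in> N \<alpha> x \<and> (\<forall>\<beta>\<in>under k \<alpha>. close \<beta> x y)}" for \<alpha> x
  have F_sym: "x \<in> F \<alpha> y" if "\<alpha> \<in> Field k" "x \<in> S" "y \<in> F \<alpha> x" for \<alpha> x y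
    using that close_sym class_sym SX by (auto simp: F_def)
  have F_trans: "z \<in> F \<alpha> x" if "\<alpha> \<in> Field k" "x \<in> S" "y \<in> F \<alpha> x" "z \<in> F \<alpha> y" for \<alpha> x y z
    using that close_trans class_eq SX by (fastforce simp: F_def)
  have "filtration k (subtopology X S) F"
  proof (unfold_locales, unfold topS)
    show "x \<in> F \<alpha> x" if "\<alpha> \<in> Field k" "x \<in> S" for \<alpha> x
      using that mem_class SX close_refl le_Field by (auto simp: F_def under_def)
    show "F \<alpha> y = F \<alpha> x" if a: "\<alpha> \<in> Field k" "x \<in> S" "y \<in> F \<alpha> x" for \<alpha> x y
    proof -
      have y: "y \<in> S"
        using a(3) by (simp add: F_def)
      show ?thesis
        using F_trans[OF a] F_trans[OF a(1) y F_sym[OF a]] by blast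
    qed
    show "openin (subtopology X S) (F \<alpha> x)" if a: "\<alpha> \<in> Field k" "x \<in> S" for \<alpha> x
    proof -
      let ?G = "\<lambda>\<beta>. {y \<in> topspace X. close \<beta> x y}"
      have "openin X (?G \<beta>)" for \<beta>
      proof -
        have "?G \<beta> = \<Union>{N \<delta> x | \<delta>. \<delta> \<in> Field k \<and> N \<delta> x \<subseteq> W \<beta>}"
          using class_sub SX[OF a(2)] by (fastforce simp: close_def)
        then show ?thesis
          using open_class SX[OF a(2)] by (auto intro!: openin_Union)
      qed
      then have "\<forall>U\<in>?G ` under k \<alpha>. openin X U"
        by blast
      then have "openin X (topspace X \<inter> \<Inter>(?G ` under k \<alpha>))"
        using additive small_image[OF small_under[OF a(1)]] unfolding card_additive_def by blast
      then have "openin X (N \<alpha> x \<inter> (topspace X \<inter> \<Inter>(?G ` under k \<alpha>)))"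
        using open_class[OF a(1) SX[OF a(2)]] by blast
      moreover have "F \<alpha> x = (N \<alpha> x \<inter> (topspace X \<inter> \<Inter>(?G ` under k \<alpha>))) \<inter> S"
        using SX by (auto simp: F_def)
      ultimately show ?thesis
        unfolding openin_subtopology by blast
    qed
    show "F \<beta> x \<subseteq> F \<alpha> x" if "\<alpha> \<preceq> \<beta>" "x \<in> S" for \<alpha> \<beta> x
      using class_anti[OF that(1) SX[OF that(2)]] le_trans[OF _ that(1)] by (auto simp: F_def under_def)
    show "\<exists>\<alpha>\<in>Field k. F \<alpha> x \<subseteq> U" if U: "openin (subtopology X S) U" "x \<in> U" for U x
    proof -
      obtain T where T: "openin X T" "U = T \<inter> S"
        using U(1) unfolding openin_subtopology by blast
      then obtain \<alpha> where "\<alpha> \<in> Field k" "N \<alpha> x \<subseteq> T"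
        using class_base U(2) by blast
      then show ?thesis
        using T(2) by (auto simp: F_def)
    qed
    show "x = y" if "x \<in> S" "y \<in> S" "\<forall>\<alpha>\<in>Field k. y \<in> F \<alpha> x" for x y
      using separated that SX by (simp add: F_def)
  qed
  moreover have "complete_filtration k (subtopology X S) F"
    unfolding complete_filtration_def topS
  proof (intro allI impI, elim conjE)
    fix s assume sS: "\<forall>\<alpha>\<in>Field k. s \<alpha> \<in> S" and s: "\<forall>\<alpha> \<beta>. \<alpha> \<preceq> \<beta> \<longrightarrow> s \<beta> \<in> F \<alpha> (s \<alpha>)"
    have "(\<forall>\<alpha>\<in>Field k. s \<alpha> \<in> topspace X) \<and> (\<forall>\<alpha> \<beta>. \<alpha> \<preceq> \<beta> \<longrightarrow> s \<beta> \<in> N \<alpha> (s \<alpha>))"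
      using sS s SX by (auto simp: F_def)
    from complete[unfolded complete_filtration_def, rule_format, OF this]
    obtain x where x: "x \<in> topspace X" "\<And>\<alpha>. \<alpha> \<in> Field k \<Longrightarrow> x \<in> N \<alpha> (s \<alpha>)"
      by blast
    have close_x: "close \<beta> (s \<alpha>) x" if ba: "\<beta> \<preceq> \<alpha>" for \<alpha> \<beta>
    proof -
      have \<alpha>: "\<alpha> \<in> Field k"
        using ba le_Field by blast
      have "s \<alpha> \<in> F \<alpha> (s \<alpha>)"
        using s le_refl[OF \<alpha>] by blast
      then have "close \<beta> (s \<alpha>) (s \<alpha>)"
        using ba by (auto simp: F_def under_def)
      then obtain \<epsilon> where "\<epsilon> \<in> Field k" "N \<epsilon> (s \<alpha>) \<subseteq> W \<beta>"
        by (auto simp: close_def)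
      (* The largest class of \<open>s \<alpha>\<close> inside \<open>W \<beta>\<close> contains all later points of the branch, although their
         being close to \<open>s \<alpha>\<close> may be witnessed by different levels. *)
      from least_exists[where P = "\<lambda>\<delta>. N \<delta> (s \<alpha>) \<subseteq> W \<beta>", OF this]
      obtain \<delta> where \<delta>: "\<delta> \<in> Field k" "N \<delta> (s \<alpha>) \<subseteq> W \<beta>"
        and least: "\<And>\<epsilon>. \<epsilon> \<in> Field k \<Longrightarrow> N \<epsilon> (s \<alpha>) \<subseteq> W \<beta> \<Longrightarrow> \<delta> \<preceq> \<epsilon>"
        by blast
      obtain \<gamma> where \<gamma>: "\<gamma> \<in> Field k" "\<alpha> \<preceq> \<gamma>" "\<delta> \<preceq> \<gamma>"
        using ex_upper_bound[OF \<alpha> \<delta>(1)] by blast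
      have sX: "s \<alpha> \<in> topspace X" "s \<gamma> \<in> topspace X"
        using sS \<alpha> \<gamma>(1) SX by blast+
      have "close \<beta> (s \<alpha>) (s \<gamma>)"
        using s \<gamma>(2) ba by (auto simp: F_def under_def)
      then obtain \<epsilon> where \<epsilon>: "\<epsilon> \<in> Field k" "s \<gamma> \<in> N \<epsilon> (s \<alpha>)" "N \<epsilon> (s \<alpha>) \<subseteq> W \<beta>"
        by (auto simp: close_def)
      have "s \<gamma> \<in> N \<delta> (s \<alpha>)"
        using class_anti[OF least[OF \<epsilon>(1,3)] sX(1)] \<epsilon>(2) by blast
      then have "N \<delta> (s \<gamma>) = N \<delta> (s \<alpha>)"
        by (rule class_eq[OF \<delta>(1) sX(1)])
      then have "x \<in> N \<delta> (s \<alpha>)"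
        using class_anti[OF \<gamma>(3) sX(2)] x(2)[OF \<gamma>(1)] by blast
      with \<delta> show ?thesis
        by (auto simp: close_def)
    qed
    have "x \<in> W \<beta>" if "\<beta> \<in> Field k" for \<beta>
      using close_x[OF le_refl[OF that]] by (auto simp: close_def)
    then have xS: "x \<in> S"
      using W(2) x(1) by blast
    moreover have "x \<in> F \<alpha> (s \<alpha>)" if "\<alpha> \<in> Field k" for \<alpha>
      using xS x(2)[OF that] close_x by (simp add: F_def under_def)
    ultimately show "\<exists>x\<in>S. \<forall>\<alpha>\<in>Field k. x \<in> F \<alpha> (s \<alpha>)"
      by blast
  qed
  ultimately show ?thesis by blast
qed


context regular_uncountable
begin

text \<open>
  The partitions are those of the summands put side by side. A branch stays in one summand since
  already the classes of the first level do not cross summands.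
\<close>

lemma complete_filtration_sum:
  assumes filt: "\<And>i. i \<in> I \<Longrightarrow> filtration k (X i) (N i)"
    and complete: "\<And>i. i \<in> I \<Longrightarrow> complete_filtration k (X i) (N i)"
    and weight: "\<And>i. i \<in> I \<Longrightarrow> weight_le (X i) k" and I: "|I| \<le>o k"
  shows "weight_le (sum_topology X I) k \<and>
    (\<exists>F. filtration k (sum_topology X I) F \<and> complete_filtration k (sum_topology X I) F)"
proof -
  define F where "F \<alpha> p = {fst p} \<times> N (fst p) \<alpha> (snd p)" for \<alpha> p
  have F: "filtration k (sum_topology X I) F"
  proof (unfold_locales, unfold topspace_sum_topology)
    fix \<alpha> p assume \<alpha>: "\<alpha> \<in> Field k" and p: "p \<in> Sigma I (topspace \<circ> X)"
    obtain i x where pi: "p = (i, x)" and i: "i \<in> I" and x: "x \<in> topspace (X i)"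
      using p by auto
    note fi = filt[OF i]
    show "p \<in> F \<alpha> p"
      using filtration.mem_class[OF fi \<alpha> x] by (simp add: F_def pi)
    have "{y. (j, y) \<in> {i} \<times> N i \<alpha> x} = (if j = i then N i \<alpha> x else {})" for j
      by auto
    then show "openin (sum_topology X I) (F \<alpha> p)"
      using filtration.open_class[OF fi \<alpha> x] filtration.class_sub[OF fi \<alpha> x] i
      by (auto simp: openin_sum_topology F_def pi)
    show "F \<alpha> q = F \<alpha> p" if "q \<in> F \<alpha> p" for q
      using that filtration.class_eq[OF fi \<alpha> x] by (auto simp: F_def pi)
  next
    fix \<alpha> \<beta> p assume ab: "\<alpha> \<preceq> \<beta>" and "p \<in> Sigma I (topspace \<circ> X)"
    then show "F \<beta> p \<subseteq> F \<alpha> p"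
      using filtration.class_anti[OF filt ab, of "fst p" "snd p"] by (fastforce simp: F_def)
  next
    fix U p assume U: "openin (sum_topology X I) U" and p: "p \<in> U"
    obtain i x where pi: "p = (i, x)" and i: "i \<in> I"
      using openin_subset[OF U] p by auto
    have "openin (X i) {y. (i, y) \<in> U}" "x \<in> {y. (i, y) \<in> U}"
      using U i p pi by (auto simp: openin_sum_topology)
    then obtain \<alpha> where "\<alpha> \<in> Field k" "N i \<alpha> x \<subseteq> {y. (i, y) \<in> U}"
      using filtration.class_base[OF filt[OF i]] by blast
    then show "\<exists>\<alpha>\<in>Field k. F \<alpha> p \<subseteq> U"
      by (intro bexI[of _ \<alpha>]) (auto simp: F_def pi)
  next
    fix p q assume p: "p \<in> Sigma I (topspace \<circ> X)" and q: "q \<in> Sigma I (topspace \<circ> X)"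
      and pq: "\<forall>\<alpha>\<in>Field k. q \<in> F \<alpha> p"
    have "fst p = fst q"
      using pq Field_nonempty by (auto simp: F_def)
    moreover have "snd p = snd q"
      using filtration.separated[OF filt, of "fst p" "snd p" "snd q"] p q pq calculation
      by (auto simp: F_def)
    ultimately show "p = q"
      by (rule prod_eqI)
  qed
  have "complete_filtration k (sum_topology X I) F"
    unfolding complete_filtration_def topspace_sum_topology
  proof (intro allI impI, elim conjE)
    fix s assume sX: "\<forall>\<alpha>\<in>Field k. s \<alpha> \<in> Sigma I (topspace \<circ> X)"
      and s: "\<forall>\<alpha> \<beta>. \<alpha> \<preceq> \<beta> \<longrightarrow> s \<beta> \<in> F \<alpha> (s \<alpha>)"
    obtain \<alpha>\<^sub>0 where \<alpha>0: "\<alpha>\<^sub>0 \<in> Field k"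
      using Field_nonempty by blast
    define i where "i = fst (s \<alpha>\<^sub>0)"
    have step: "fst (s \<beta>) = fst (s \<alpha>)" "snd (s \<beta>) \<in> N (fst (s \<alpha>)) \<alpha> (snd (s \<alpha>))" if "\<alpha> \<preceq> \<beta>" for \<alpha> \<beta>
      using s[rule_format, OF that] by (auto simp: F_def)
    have fst_s: "fst (s \<alpha>) = i" if "\<alpha> \<in> Field k" for \<alpha>
      using le_total[OF that \<alpha>0] step(1) by (metis i_def)
    have i: "i \<in> I"
      using sX \<alpha>0 by (auto simp: i_def)
    have "(\<forall>\<alpha>\<in>Field k. snd (s \<alpha>) \<in> topspace (X i)) \<and>
        (\<forall>\<alpha> \<beta>. \<alpha> \<preceq> \<beta> \<longrightarrow> snd (s \<beta>) \<in> N i \<alpha> (snd (s \<alpha>)))"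
    proof (intro conjI ballI allI impI)
      show "snd (s \<alpha>) \<in> topspace (X i)" if "\<alpha> \<in> Field k" for \<alpha>
        using bspec[OF sX that] fst_s[OF that] by auto
      show "snd (s \<beta>) \<in> N i \<alpha> (snd (s \<alpha>))" if "\<alpha> \<preceq> \<beta>" for \<alpha> \<beta>
        using step(2)[OF that] fst_s le_Field that by metis
    qed
    from complete[OF i, unfolded complete_filtration_def, rule_format, OF this]
    obtain x where x: "x \<in> topspace (X i)" "\<And>\<alpha>. \<alpha> \<in> Field k \<Longrightarrow> x \<in> N i \<alpha> (snd (s \<alpha>))"
      by blast
    show "\<exists>p\<in>Sigma I (topspace \<circ> X). \<forall>\<alpha>\<in>Field k. p \<in> F \<alpha> (s \<alpha>)"
      using i x fst_s by (intro bexI[of _ "(i, x)"]) (auto simp: F_def)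
  qed
  moreover have "weight_le (sum_topology X I) k"
  proof -
    have "\<forall>i\<in>I. \<exists>c. \<forall>\<alpha>\<in>Field k. c \<alpha> ` topspace (X i) \<subseteq> Field k \<and>
        (\<forall>x\<in>topspace (X i). \<forall>y\<in>topspace (X i). c \<alpha> x = c \<alpha> y \<longrightarrow> y \<in> N i \<alpha> x)"
      using filtration.classes_coded_if_weight_le[OF filt weight] by (rule ballI)
    from bchoice[OF this] obtain c where c: "\<forall>i\<in>I. \<forall>\<alpha>\<in>Field k. c i \<alpha> ` topspace (X i) \<subseteq> Field k \<and>
        (\<forall>x\<in>topspace (X i). \<forall>y\<in>topspace (X i). c i \<alpha> x = c i \<alpha> y \<longrightarrow> y \<in> N i \<alpha> x)"
      by (rule exE)
    show ?thesis
    proof (rule filtration.weight_le_if_classes_coded[OF F,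
          where Z = "I \<times> Field k" and c = "\<lambda>\<alpha> p. (fst p, c (fst p) \<alpha> (snd p))"])
      show "|I \<times> Field k| \<le>o k"
        using card_of_le_times I card_of_Field_le by blast
      show "(\<lambda>p. (fst p, c (fst p) \<alpha> (snd p))) ` topspace (sum_topology X I) \<subseteq> I \<times> Field k"
        if "\<alpha> \<in> Field k" for \<alpha>
        using c that by fastforce
      show "q \<in> F \<alpha> p" if \<alpha>: "\<alpha> \<in> Field k" and "p \<in> topspace (sum_topology X I)"
        "q \<in> topspace (sum_topology X I)"
        "(fst p, c (fst p) \<alpha> (snd p)) = (fst q, c (fst q) \<alpha> (snd q))" for \<alpha> p q
      proof -
        have i: "fst p \<in> I" "fst q = fst p" and xy: "snd p \<in> topspace (X (fst p))" "snd q \<in> topspace (X (fst p))"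
          and eq: "c (fst p) \<alpha> (snd p) = c (fst p) \<alpha> (snd q)"
          using that by auto
        have "snd q \<in> N (fst p) \<alpha> (snd p)"
          using bspec[OF bspec[OF c i(1)] \<alpha>] xy eq by blast
        then show ?thesis
          using i(2) by (simp add: F_def mem_Times_iff)
      qed
    qed
  qed
  ultimately show ?thesis
    using F by blast
qed

lemma topspace_supported_product:
  "topspace (supported_product_topology k X I) = Pi\<^sub>E I (topspace \<circ> X)"
proof -
  have "|{}| <o k"
    using small_subset[OF small_range_nat] by blast
  then have "Pi\<^sub>E I (topspace \<circ> X) \<in> {Pi\<^sub>E I U | U. (\<forall>i\<in>I. openin (X i) (U i)) \<and>
      |{i\<in>I. U i \<noteq> topspace (X i)}| <o k}"
    by (intro CollectI exI[of _ "topspace \<circ> X"]) simp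
  moreover have "Pi\<^sub>E I U \<subseteq> Pi\<^sub>E I (topspace \<circ> X)" if "\<forall>i\<in>I. openin (X i) (U i)" for U
    using that openin_subset by (intro PiE_mono) fastforce
  ultimately show ?thesis
    unfolding supported_product_topology_def topology_generated_by_topspace by blast
qed

text \<open>
  The coordinates are numbered by \<open>e\<close>. At level \<open>\<alpha>\<close> only the coordinates numbered up to \<open>\<alpha>\<close> are compared,
  at level \<open>\<alpha>\<close> of their own filtrations. As these are fewer than \<open>\<kappa>\<close>, the classes are basic open sets.
  A class is coded by the set of pairs consisting of the number of a coordinate and the code of the class
  there; pairs of ordinals below \<open>\<kappa>\<close> being coded by single ones, this is a subset of \<open>\<kappa>\<close> of size less than
  \<open>\<kappa>\<close>.
\<close>

lemma complete_filtration_product: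
  assumes filt: "\<And>i. i \<in> I \<Longrightarrow> filtration k (X i) (N i)"
    and complete: "\<And>i. i \<in> I \<Longrightarrow> complete_filtration k (X i) (N i)"
    and weight: "\<And>i. i \<in> I \<Longrightarrow> weight_le (X i) k" and I: "|I| \<le>o k"
    and seqs: "|short_binary_seqs k| =o k"
  shows "weight_le (supported_product_topology k X I) k \<and>
    (\<exists>F. filtration k (supported_product_topology k X I) F \<and>
      complete_filtration k (supported_product_topology k X I) F)"
proof -
  let ?X = "supported_product_topology k X I" and ?M = "Pi\<^sub>E I (topspace \<circ> X)"
  obtain e where e: "inj_on e I" "e ` I \<subseteq> Field k"
    using coding_exists[OF I] by blast
  have eF: "e i \<in> Field k" if "i \<in> I" for i
    using that e(2) by blast
  define F where "F \<alpha> f = {g \<in> ?M. \<forall>i\<in>I. e i \<preceq> \<alpha> \<longrightarrow> g i \<in> N i \<alpha> (f i)}" for \<alpha> f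
  have comp: "f i \<in> topspace (X i)" if "f \<in> ?M" "i \<in> I" for f i
    using that by auto
  have small_initial: "|{i \<in> I. e i \<preceq> \<alpha>}| <o k" if "\<alpha> \<in> Field k" for \<alpha>
  proof -
    have "inj_on e {i \<in> I. e i \<preceq> \<alpha>}" "e ` {i \<in> I. e i \<preceq> \<alpha>} \<subseteq> under k \<alpha>"
      using e(1) by (auto simp: inj_on_def under_def)
    then have "|{i \<in> I. e i \<preceq> \<alpha>}| \<le>o |under k \<alpha>|"
      using card_of_ordLeq by blast
    then show ?thesis
      using small_under[OF that] ordLeq_ordLess_trans by blast
  qed
  have F_anti: "F \<beta> f \<subseteq> F \<alpha> f" if ab: "\<alpha> \<preceq> \<beta>" and f: "f \<in> ?M" for \<alpha> \<beta> f
  proof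
    fix g assume g: "g \<in> F \<beta> f"
    have "g i \<in> N i \<alpha> (f i)" if "i \<in> I" "e i \<preceq> \<alpha>" for i
      using g that le_trans[OF that(2) ab] filtration.class_anti[OF filt[OF that(1)] ab comp[OF f that(1)]]
      by (auto simp: F_def)
    with g show "g \<in> F \<alpha> f"
      by (simp add: F_def)
  qed
  have F: "filtration k ?X F"
  proof (unfold_locales, unfold topspace_supported_product)
    fix \<alpha> f assume \<alpha>: "\<alpha> \<in> Field k" and f: "f \<in> ?M"
    show "f \<in> F \<alpha> f"
      using f filtration.mem_class[OF filt \<alpha> comp[OF f]] by (simp add: F_def)
    show "F \<alpha> g = F \<alpha> f" if g: "g \<in> F \<alpha> f" for g
    proof -
      have "N i \<alpha> (g i) = N i \<alpha> (f i)" if "i \<in> I" "e i \<preceq> \<alpha>" for i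
        using filtration.class_eq[OF filt[OF that(1)] \<alpha> comp[OF f that(1)]] g that by (auto simp: F_def)
      then show ?thesis
        by (auto simp: F_def)
    qed
    define U where "U i = (if e i \<preceq> \<alpha> then N i \<alpha> (f i) else topspace (X i))" for i
    have U: "openin (X i) (U i)" if "i \<in> I" for i
      using filtration.open_class[OF filt[OF that] \<alpha> comp[OF f that]] by (simp add: U_def)
    have "|{i\<in>I. U i \<noteq> topspace (X i)}| <o k"
      by (rule small_subset[OF small_initial[OF \<alpha>]]) (auto simp: U_def)
    then have "openin ?X (Pi\<^sub>E I U)"
      unfolding supported_product_topology_def using U
      by (intro topology_generated_by_Basis) blast
    moreover have "F \<alpha> f = Pi\<^sub>E I U"
    proof (intro equalityI subsetI)
      fix g assume "g \<in> F \<alpha> f"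
      then show "g \<in> Pi\<^sub>E I U"
        by (auto simp: F_def U_def PiE_iff)
    next
      fix g assume g: "g \<in> Pi\<^sub>E I U"
      have "g i \<in> topspace (X i)" if "i \<in> I" for i
        using g that openin_subset[OF U[OF that]] by (auto simp: PiE_iff)
      then show "g \<in> F \<alpha> f"
        using g by (auto simp: F_def U_def PiE_iff)
    qed
    ultimately show "openin ?X (F \<alpha> f)"
      by simp
  next
    show "F \<beta> f \<subseteq> F \<alpha> f" if "\<alpha> \<preceq> \<beta>" "f \<in> ?M" for \<alpha> \<beta> f
      using F_anti[OF that] .
  next
    fix U f assume U: "openin ?X U" and f: "f \<in> U"
    from U have "generate_topology_on {Pi\<^sub>E I U | U. (\<forall>i\<in>I. openin (X i) (U i)) \<and>
        |{i\<in>I. U i \<noteq> topspace (X i)}| <o k} U"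
      unfolding supported_product_topology_def openin_topology_generated_by_iff .
    then have nbhd: "\<forall>f\<in>U. f \<in> ?M \<longrightarrow> (\<exists>\<alpha>\<in>Field k. F \<alpha> f \<subseteq> U)"
    proof induction
      case (Int A B)
      show ?case
      proof (intro ballI impI)
        fix f assume fAB: "f \<in> A \<inter> B" and f: "f \<in> ?M"
        obtain \<alpha> \<beta> where \<alpha>: "\<alpha> \<in> Field k" "F \<alpha> f \<subseteq> A" and \<beta>: "\<beta> \<in> Field k" "F \<beta> f \<subseteq> B"
          using Int.IH fAB f by blast
        obtain \<gamma> where "\<gamma> \<in> Field k" "\<alpha> \<preceq> \<gamma>" "\<beta> \<preceq> \<gamma>"
          using ex_upper_bound[OF \<alpha>(1) \<beta>(1)] by blast
        then show "\<exists>\<gamma>\<in>Field k. F \<gamma> f \<subseteq> A \<inter> B"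
          using F_anti[OF _ f] \<alpha>(2) \<beta>(2) by blast
      qed
    next
      case (UN \<K>)
      show ?case
      proof (intro ballI impI)
        fix f assume "f \<in> \<Union>\<K>" and f: "f \<in> ?M"
        then obtain A where A: "A \<in> \<K>" "f \<in> A"
          by blast
        then obtain \<alpha> where "\<alpha> \<in> Field k" "F \<alpha> f \<subseteq> A"
          using UN.IH[OF A(1)] f by blast
        then show "\<exists>\<alpha>\<in>Field k. F \<alpha> f \<subseteq> \<Union>\<K>"
          using A(1) by blast
      qed
    next
      case (Basis B)
      then obtain T where T: "\<forall>i\<in>I. openin (X i) (T i)" "|{i\<in>I. T i \<noteq> topspace (X i)}| <o k"
        and B: "B = Pi\<^sub>E I T"
        by blast
      let ?J = "{i\<in>I. T i \<noteq> topspace (X i)}"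
      show ?case
      proof (intro ballI impI)
        fix f assume fB: "f \<in> B" and f: "f \<in> ?M"
        have "\<forall>i\<in>?J. \<exists>\<alpha>. \<alpha> \<in> Field k \<and> N i \<alpha> (f i) \<subseteq> T i"
        proof
          fix i assume i: "i \<in> ?J"
          then have "openin (X i) (T i)" "f i \<in> T i"
            using T(1) fB by (auto simp: B)
          then show "\<exists>\<alpha>. \<alpha> \<in> Field k \<and> N i \<alpha> (f i) \<subseteq> T i"
            using filtration.class_base[OF filt, of i] i by blast
        qed
        from bchoice[OF this]
        obtain a where a: "\<forall>i\<in>?J. a i \<in> Field k \<and> N i (a i) (f i) \<subseteq> T i"
          by (rule exE)
        then obtain \<beta> where \<beta>: "\<beta> \<in> Field k" "\<forall>i\<in>?J. a i \<preceq> \<beta>"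
          using small_bounded[OF T(2), of a] by blast
        obtain \<gamma> where \<gamma>: "\<gamma> \<in> Field k" "\<forall>i\<in>?J. e i \<preceq> \<gamma>"
          using small_bounded[OF T(2), of e] eF by blast
        obtain \<delta> where \<delta>: "\<delta> \<in> Field k" "\<beta> \<preceq> \<delta>" "\<gamma> \<preceq> \<delta>"
          using ex_upper_bound[OF \<beta>(1) \<gamma>(1)] by blast
        have "F \<delta> f \<subseteq> B"
        proof
          fix g assume g: "g \<in> F \<delta> f"
          have "g i \<in> T i" if i: "i \<in> I" for i
          proof (cases "i \<in> ?J")
            case True
            have "e i \<preceq> \<delta>" "a i \<preceq> \<delta>"
              using \<gamma>(2) \<beta>(2) \<delta> True le_trans by blast+
            then have "g i \<in> N i \<delta> (f i)"
              using g i by (simp add: F_def)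
            then show ?thesis
              using filtration.class_anti[OF filt[OF i] \<open>a i \<preceq> \<delta>\<close> comp[OF f i]] bspec[OF a True]
              by blast
          next
            case False
            then show ?thesis
              using g i comp[of g i] by (auto simp: F_def)
          qed
          then show "g \<in> B"
            using g by (auto simp: B F_def PiE_iff)
        qed
        with \<delta>(1) show "\<exists>\<delta>\<in>Field k. F \<delta> f \<subseteq> B"
          by blast
      qed
    qed simp
    have "f \<in> ?M"
      using subsetD[OF openin_subset[OF U] f] unfolding topspace_supported_product .
    with bspec[OF nbhd f] show "\<exists>\<alpha>\<in>Field k. F \<alpha> f \<subseteq> U"
      by (rule mp)
  next
    fix f g assume f: "f \<in> ?M" and g: "g \<in> ?M" and fg: "\<forall>\<alpha>\<in>Field k. g \<in> F \<alpha> f"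
    show "f = g"
    proof (rule PiE_ext[OF f g])
      fix i assume i: "i \<in> I"
      have "g i \<in> N i \<alpha> (f i)" if \<alpha>: "\<alpha> \<in> Field k" for \<alpha>
      proof -
        obtain \<gamma> where \<gamma>: "\<gamma> \<in> Field k" "\<alpha> \<preceq> \<gamma>" "e i \<preceq> \<gamma>"
          using ex_upper_bound[OF \<alpha> eF[OF i]] by blast
        then have "g i \<in> N i \<gamma> (f i)"
          using fg i by (auto simp: F_def)
        then show ?thesis
          using filtration.class_anti[OF filt[OF i] \<gamma>(2) comp[OF f i]] by blast
      qed
      then show "f i = g i"
        using filtration.separated[OF filt[OF i] comp[OF f i] comp[OF g i]] by blast
    qed
  qed
  have "complete_filtration k ?X F"
    unfolding complete_filtration_def topspace_supported_product
  proof (intro allI impI, elim conjE)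
    fix s assume sM: "\<forall>\<alpha>\<in>Field k. s \<alpha> \<in> ?M" and s: "\<forall>\<alpha> \<beta>. \<alpha> \<preceq> \<beta> \<longrightarrow> s \<beta> \<in> F \<alpha> (s \<alpha>)"
    (* The coordinate \<open>i\<close> of \<open>s\<close> is coherent only from level \<open>e i\<close> on, so earlier entries are replaced by
       the one at that level. *)
    define mx where "mx i \<alpha> = (if e i \<preceq> \<alpha> then \<alpha> else e i)" for i \<alpha>
    have mx: "mx i \<alpha> \<in> Field k" "\<alpha> \<preceq> mx i \<alpha>" "e i \<preceq> mx i \<alpha>" if "i \<in> I" "\<alpha> \<in> Field k" for i \<alpha>
      using le_refl[OF that(2)] le_refl[OF eF[OF that(1)]] le_total[OF eF[OF that(1)] that(2)] that eF
      by (auto simp: mx_def)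
    have mx_mono: "mx i \<alpha> \<preceq> mx i \<beta>" if i: "i \<in> I" and ab: "\<alpha> \<preceq> \<beta>" for i \<alpha> \<beta>
    proof -
      have F: "\<alpha> \<in> Field k" "\<beta> \<in> Field k"
        using ab le_Field by auto
      show ?thesis
        using le_trans[OF ab mx(2)[OF i F(2)]] mx(3)[OF i F(2)] by (simp add: mx_def[of i \<alpha>])
    qed
    have "\<forall>i\<in>I. \<exists>x. x \<in> topspace (X i) \<and> (\<forall>\<alpha>\<in>Field k. x \<in> N i \<alpha> (s (mx i \<alpha>) i))"
    proof
      fix i assume i: "i \<in> I"
      have "(\<forall>\<alpha>\<in>Field k. s (mx i \<alpha>) i \<in> topspace (X i)) \<and>
          (\<forall>\<alpha> \<beta>. \<alpha> \<preceq> \<beta> \<longrightarrow> s (mx i \<beta>) i \<in> N i \<alpha> (s (mx i \<alpha>) i))"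
      proof (intro conjI ballI allI impI)
        show st: "s (mx i \<alpha>) i \<in> topspace (X i)" if "\<alpha> \<in> Field k" for \<alpha>
          using comp[OF bspec[OF sM mx(1)[OF i that]] i] .
        show "s (mx i \<beta>) i \<in> N i \<alpha> (s (mx i \<alpha>) i)" if ab: "\<alpha> \<preceq> \<beta>" for \<alpha> \<beta>
        proof -
          have \<alpha>: "\<alpha> \<in> Field k"
            using ab le_Field by blast
          have "s (mx i \<beta>) \<in> F (mx i \<alpha>) (s (mx i \<alpha>))"
            using s mx_mono[OF i ab] by blast
          then have "s (mx i \<beta>) i \<in> N i (mx i \<alpha>) (s (mx i \<alpha>) i)"
            using i mx(3)[OF i \<alpha>] by (auto simp: F_def)
          then show ?thesis
            using filtration.class_anti[OF filt[OF i] mx(2)[OF i \<alpha>] st[OF \<alpha>]] by blast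
        qed
      qed
      from complete[OF i, unfolded complete_filtration_def, rule_format,
          where s = "\<lambda>\<alpha>. s (mx i \<alpha>) i", OF this]
      show "\<exists>x. x \<in> topspace (X i) \<and> (\<forall>\<alpha>\<in>Field k. x \<in> N i \<alpha> (s (mx i \<alpha>) i))"
        by blast
    qed
    from bchoice[OF this] obtain x where
      x: "\<forall>i\<in>I. x i \<in> topspace (X i) \<and> (\<forall>\<alpha>\<in>Field k. x i \<in> N i \<alpha> (s (mx i \<alpha>) i))"
      by (rule exE)
    have xM: "restrict x I \<in> ?M"
      using x by auto
    moreover have "restrict x I \<in> F \<alpha> (s \<alpha>)" if \<alpha>: "\<alpha> \<in> Field k" for \<alpha>
    proof -
      have "x i \<in> N i \<alpha> (s \<alpha> i)" if "i \<in> I" "e i \<preceq> \<alpha>" for i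
        using bspec[OF x that(1)] \<alpha> that(2) by (auto simp: mx_def)
      then show ?thesis
        using xM by (simp add: F_def)
    qed
    ultimately show "\<exists>f\<in>?M. \<forall>\<alpha>\<in>Field k. f \<in> F \<alpha> (s \<alpha>)"
      by blast
  qed
  moreover have "weight_le ?X k"
  proof -
    have "\<forall>i\<in>I. \<exists>c. \<forall>\<alpha>\<in>Field k. c \<alpha> ` topspace (X i) \<subseteq> Field k \<and>
        (\<forall>x\<in>topspace (X i). \<forall>y\<in>topspace (X i). c \<alpha> x = c \<alpha> y \<longrightarrow> y \<in> N i \<alpha> x)"
      using filtration.classes_coded_if_weight_le[OF filt weight] by (rule ballI)
    from bchoice[OF this] obtain c where c: "\<forall>i\<in>I. \<forall>\<alpha>\<in>Field k. c i \<alpha> ` topspace (X i) \<subseteq> Field k \<and>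
        (\<forall>x\<in>topspace (X i). \<forall>y\<in>topspace (X i). c i \<alpha> x = c i \<alpha> y \<longrightarrow> y \<in> N i \<alpha> x)"
      by (rule exE)
    obtain p where p: "inj_on p (Field k \<times> Field k)" "p ` (Field k \<times> Field k) \<subseteq> Field k"
      using coding_exists[OF card_of_le_times[OF card_of_Field_le card_of_Field_le]] by blast
    define code where "code \<alpha> f = (\<lambda>i. p (e i, c i \<alpha> (f i))) ` {i \<in> I. e i \<preceq> \<alpha>}" for \<alpha> f
    have cF: "c i \<alpha> (f i) \<in> Field k" if "i \<in> I" "\<alpha> \<in> Field k" "f \<in> ?M" for i \<alpha> f
      using bspec[OF bspec[OF c that(1)] that(2)] comp[OF that(3,1)] by blast
    show ?thesis
    proof (rule filtration.weight_le_if_classes_coded[OF F card_of_small_subsets[OF seqs], where c = code],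
        unfold topspace_supported_product)
      show "code \<alpha> ` ?M \<subseteq> {A. A \<subseteq> Field k \<and> |A| <o k}" if \<alpha>: "\<alpha> \<in> Field k" for \<alpha>
      proof
        fix A assume "A \<in> code \<alpha> ` ?M"
        then obtain f where f: "f \<in> ?M" and A: "A = code \<alpha> f"
          by blast
        have "p (e i, c i \<alpha> (f i)) \<in> Field k" if "i \<in> I" for i
          using p(2) eF[OF that] cF[OF that \<alpha> f] by blast
        then have "code \<alpha> f \<subseteq> Field k"
          by (auto simp: code_def)
        moreover have "|code \<alpha> f| <o k"
          unfolding code_def by (rule small_image[OF small_initial[OF \<alpha>]])
        ultimately show "A \<in> {A. A \<subseteq> Field k \<and> |A| <o k}"
          by (simp add: A)
      qed
      show "g \<in> F \<alpha> f" if \<alpha>: "\<alpha> \<in> Field k" and f: "f \<in> ?M" and g: "g \<in> ?M"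
        and eq: "code \<alpha> f = code \<alpha> g" for \<alpha> f g
      proof -
        have "g i \<in> N i \<alpha> (f i)" if i: "i \<in> I" "e i \<preceq> \<alpha>" for i
        proof -
          have "p (e i, c i \<alpha> (f i)) \<in> code \<alpha> g"
            unfolding eq[symmetric] using i by (auto simp: code_def)
          then obtain j where j: "j \<in> I" "p (e i, c i \<alpha> (f i)) = p (e j, c j \<alpha> (g j))"
            by (auto simp: code_def)
          have "(e i, c i \<alpha> (f i)) = (e j, c j \<alpha> (g j))"
            by (rule inj_onD[OF p(1) j(2)]) (use eF cF i(1) j(1) \<alpha> f g in auto)
          moreover from this have "i = j"
            using inj_onD[OF e(1) _ i(1) j(1)] by blast
          ultimately show ?thesis
            using bspec[OF bspec[OF c i(1)] \<alpha>] comp[OF f i(1)] comp[OF g i(1)] by blast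
        qed
        with g show ?thesis
          by (simp add: F_def)
      qed
    qed
  qed
  ultimately show ?thesis
    using F by blast
qed

end

section \<open>The characterization and the closure properties\<close>

theorem theorem5p2:
  fixes k :: "'k rel"
  assumes "admissible_cardinal k"
    and "Deg_eq TYPE('g::linordered_ab_group_add) k"
  shows "(\<forall>X :: 'a topology.
            G_Polish TYPE('g) k X \<longleftrightarrow> card_additive k X \<and> fSC_space k X) \<and>
         (\<forall>(X :: 'a topology) S.
            G_Polish TYPE('g) k X \<and> card_gdelta_in k X S \<longrightarrow>
            G_Polish TYPE('g) k (subtopology X S)) \<and>
         (\<forall>(X :: 'i \<Rightarrow> 'a topology) I.
            |I| \<le>o k \<and> (\<forall>i\<in>I. G_Polish TYPE('g) k (X i)) \<longrightarrow>
            G_Polish TYPE('g) k (sum_topology X I)) \<and>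
         (\<forall>(X :: 'i \<Rightarrow> 'a topology) I.
            |I| \<le>o k \<and> (\<forall>i\<in>I. G_Polish TYPE('g) k (X i)) \<longrightarrow>
            G_Polish TYPE('g) k (supported_product_topology k X I))"
proof -
  from assms(1) have seqs: "|short_binary_seqs k| =o k"
    by (simp add: admissible_cardinal_def)
  interpret regular_uncountable k
    using assms(1) by unfold_locales (simp_all add: admissible_cardinal_def)
  note Polish = G_Polish_iff_complete_filtration[OF assms(2)]
  have equiv: "G_Polish TYPE('g) k X \<longleftrightarrow> card_additive k X \<and> fSC_space k X" for X :: "'a topology"
    by (simp only: Polish additive_fSC_iff_complete_filtration)
  have gdelta: "G_Polish TYPE('g) k (subtopology X S)"
    if "G_Polish TYPE('g) k X" "card_gdelta_in k X S" for X :: "'a topology" and S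
  proof -
    obtain N where N: "weight_le X k" "filtration k X N" "complete_filtration k X N"
      using \<open>G_Polish TYPE('g) k X\<close> Polish by blast
    show ?thesis
      unfolding Polish
      using weight_le_subtopology[OF N(1)] filtration.filtration_gdelta[OF N(2,3) that(2)] by blast
  qed
  have filtrations: "\<exists>N. \<forall>i\<in>I. weight_le (X i) k \<and> filtration k (X i) (N i) \<and> complete_filtration k (X i) (N i)"
    if "\<forall>i\<in>I. G_Polish TYPE('g) k (X i)" for X :: "'i \<Rightarrow> 'a topology" and I
  proof (rule bchoice, rule ballI)
    fix i assume "i \<in> I"
    then show "\<exists>N. weight_le (X i) k \<and> filtration k (X i) N \<and> complete_filtration k (X i) N"
      using that Polish by blast
  qed
  have sum: "G_Polish TYPE('g) k (sum_topology X I)"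
    if I: "|I| \<le>o k" "\<forall>i\<in>I. G_Polish TYPE('g) k (X i)" for X :: "'i \<Rightarrow> 'a topology" and I
  proof -
    obtain N where N: "\<forall>i\<in>I. weight_le (X i) k \<and> filtration k (X i) (N i) \<and> complete_filtration k (X i) (N i)"
      using filtrations[OF I(2)] by (rule exE)
    show ?thesis
      unfolding Polish by (rule complete_filtration_sum[where N = N]) (use N I in auto)
  qed
  have product: "G_Polish TYPE('g) k (supported_product_topology k X I)"
    if I: "|I| \<le>o k" "\<forall>i\<in>I. G_Polish TYPE('g) k (X i)" for X :: "'i \<Rightarrow> 'a topology" and I
  proof -
    obtain N where N: "\<forall>i\<in>I. weight_le (X i) k \<and> filtration k (X i) (N i) \<and> complete_filtration k (X i) (N i)"
      using filtrations[OF I(2)] by (rule exE)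
    show ?thesis
      unfolding Polish by (rule complete_filtration_product[where N = N]) (use N I seqs in auto)
  qed
  show ?thesis
    using equiv gdelta sum product by simp
qed

end
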